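(* Assume Assumptions (A1)–(A3) hold, let $g^*,h^*$ be limits $g^*=\lim_k\alpha_{n_k}J^*_{\alpha_{n_k}}(i_0)$, $h^*(j)=\lim_kh_{\alpha_{n_k}}(j)$ along a subsequence, satisfying the average-cost optimality inequality $g^*\ge\min_{a\in A(i)}\{c(i,a)+\sum_jh^*(j)q(j|i,a)\}$ for all $i\in S$, and let $e$ be a stationary policy attaining this minimum for every $i$. Define $\Phi\ge0$ by $$g^*=c(i,e(i))+\Phi(i)+\sum_{j\in S}q(j|i,e(i))h^*(j),\quad i\in S.$$ Let $i\in S$. Then $\Phi(i)=0$ (so the optimality equality $g^*=\min_{a\in A(i)}\{c(i,a)+\sum_jh^*(j)q(j|i,a)\}$ holds at $i$) under any of the following conditions: (i) there is a nonempty set $G\subseteq S$ with $e\in\mathfrak R(i,G)$ and $\sum_{j\in G}H(j)P_e(x(T)=j\mid x(0)=i)<\infty$, where $T$ is the first passage time from $i$ to $G$; (ii) $e\in\mathfrak R(i,i_0)$; (iii) the Markov chain induced by $e$ is positive recurrent at $i$; (iv) $\sum_{j\in S}|q(j|i,a)|H(j)<\infty$ for all $a\in A(i)$.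
   Context: CTMDP: denumerable state space $S$, finite action sets $A(i)$, conservative transition rates $q(j|i,a)$ ($q(j|i,a)\ge0$ for $j\ne i$, $\sum_jq(j|i,a)=0$), cost rates $c(i,a)\ge0$; processes nonexplosive. $J^*_\alpha(i)=\inf_{\pi}\int_0^\infty e^{-\alpha t}E_i^\pi[c(x(t),\pi_t)]dt$ over randomized Markov policies. Assumptions A: for some decreasing sequence $\alpha_n\to0$ and some state $i_0$: (A1) $\alpha_nJ^*_{\alpha_n}(i_0)$ is bounded in $n$; (A2) there is a finite nonnegative function $H$ with $h_{\alpha_n}(i)\le H(i)$ for all $i,n$, where $h_\alpha(i)=J^*_\alpha(i)-J^*_\alpha(i_0)$; (A3) there is a constant $L\ge0$ with $-L\le h_{\alpha_n}(i)$ for all $i,n$. The first passage time from $i$ to $G$ is $T=\inf\{t>0:x(t)\in G$, at least one transition has occurred$\}$. $\mathfrak R(i,G)$ is the class of policies $\theta$ with $P_\theta(T<\infty\mid x(0)=i)=1$ and $m_{i,G}(\theta):=E_\theta[T\mid x(0)=i]<\infty$; $\mathfrak R(i,x):=\mathfrak R(i,\{x\})$. *)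

theory Defs
  imports "HOL-Probability.Probability"
begin

(* Conventions: states have a countable type 's; actions have type 'b;
   A i is the admissible action set; q j i a denotes the rate q(j|i,a);
   c i a is the cost rate c(i,a). *)

definition conservative :: "('s \<Rightarrow> 'b set) \<Rightarrow> ('s \<Rightarrow> 's \<Rightarrow> 'b \<Rightarrow> real) \<Rightarrow> bool" where
  "conservative A q \<longleftrightarrow>
     (\<forall>i. \<forall>a\<in>A i. (\<forall>j. j \<noteq> i \<longrightarrow> 0 \<le> q j i a) \<and> ((\<lambda>j. q j i a) has_sum 0) UNIV)"

definition markov_policy :: "('s \<Rightarrow> 'b set) \<Rightarrow> (real \<Rightarrow> 's \<Rightarrow> 'b pmf) \<Rightarrow> bool" where
  "markov_policy A \<pi> \<longleftrightarrow>
     (\<forall>t i. set_pmf (\<pi> t i) \<subseteq> A i) \<and> (\<forall>i a. (\<lambda>t. pmf (\<pi> t i) a) \<in> borel_measurable borel)"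

definition pol_rate :: "('s \<Rightarrow> 'b set) \<Rightarrow> ('s \<Rightarrow> 's \<Rightarrow> 'b \<Rightarrow> real) \<Rightarrow> (real \<Rightarrow> 's \<Rightarrow> 'b pmf)
    \<Rightarrow> real \<Rightarrow> 's \<Rightarrow> 's \<Rightarrow> real" where
  "pol_rate A q \<pi> t j i = (\<Sum>a\<in>A i. pmf (\<pi> t i) a * q j i a)"

definition pol_cost :: "('s \<Rightarrow> 'b set) \<Rightarrow> ('s \<Rightarrow> 'b \<Rightarrow> real) \<Rightarrow> (real \<Rightarrow> 's \<Rightarrow> 'b pmf)
    \<Rightarrow> real \<Rightarrow> 's \<Rightarrow> real" where
  "pol_cost A c \<pi> t i = (\<Sum>a\<in>A i. pmf (\<pi> t i) a * c i a)"

definition out_int :: "('s \<Rightarrow> 'b set) \<Rightarrow> ('s \<Rightarrow> 's \<Rightarrow> 'b \<Rightarrow> real) \<Rightarrow> (real \<Rightarrow> 's \<Rightarrow> 'b pmf)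
    \<Rightarrow> 's \<Rightarrow> real \<Rightarrow> real \<Rightarrow> real" where
  "out_int A q \<pi> i s u = set_lebesgue_integral lborel {s..u} (\<lambda>v. - pol_rate A q \<pi> v i i)"

(* Feller's iterative construction of the minimal transition function P^pi(s,i,t,j) *)
fun trans_n :: "('s \<Rightarrow> 'b set) \<Rightarrow> ('s \<Rightarrow> 's \<Rightarrow> 'b \<Rightarrow> real) \<Rightarrow> (real \<Rightarrow> 's \<Rightarrow> 'b pmf)
    \<Rightarrow> nat \<Rightarrow> real \<Rightarrow> 's \<Rightarrow> real \<Rightarrow> 's \<Rightarrow> ennreal" where
  "trans_n A q \<pi> 0 s i t j = (if i = j then ennreal (exp (- out_int A q \<pi> i s t)) else 0)"
| "trans_n A q \<pi> (Suc n) s i t j =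
     set_nn_integral lborel {s..t} (\<lambda>u. ennreal (exp (- out_int A q \<pi> i s u)) *
        (\<integral>\<^sup>+ k. ennreal (pol_rate A q \<pi> u k i) * trans_n A q \<pi> n u k t j \<partial>count_space (UNIV - {i})))"

definition trans_fun :: "('s \<Rightarrow> 'b set) \<Rightarrow> ('s \<Rightarrow> 's \<Rightarrow> 'b \<Rightarrow> real) \<Rightarrow> (real \<Rightarrow> 's \<Rightarrow> 'b pmf)
    \<Rightarrow> real \<Rightarrow> 's \<Rightarrow> real \<Rightarrow> 's \<Rightarrow> ennreal" where
  "trans_fun A q \<pi> s i t j = (\<Sum>n. trans_n A q \<pi> n s i t j)"

definition nonexplosive :: "('s \<Rightarrow> 'b set) \<Rightarrow> ('s \<Rightarrow> 's \<Rightarrow> 'b \<Rightarrow> real) \<Rightarrow> bool" where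
  "nonexplosive A q \<longleftrightarrow>
     (\<forall>\<pi>. markov_policy A \<pi> \<longrightarrow>
        (\<forall>s t i. s \<le> t \<longrightarrow> (\<integral>\<^sup>+ j. trans_fun A q \<pi> s i t j \<partial>count_space UNIV) = 1))"

definition disc_cost :: "('s \<Rightarrow> 'b set) \<Rightarrow> ('s \<Rightarrow> 's \<Rightarrow> 'b \<Rightarrow> real) \<Rightarrow> ('s \<Rightarrow> 'b \<Rightarrow> real)
    \<Rightarrow> (real \<Rightarrow> 's \<Rightarrow> 'b pmf) \<Rightarrow> real \<Rightarrow> 's \<Rightarrow> ennreal" where
  "disc_cost A q c \<pi> \<alpha> i =
     set_nn_integral lborel {0..} (\<lambda>t. ennreal (exp (- \<alpha> * t)) *
        (\<integral>\<^sup>+ j. trans_fun A q \<pi> 0 i t j * ennreal (pol_cost A c \<pi> t j) \<partial>count_space UNIV))"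

definition opt_disc_cost :: "('s \<Rightarrow> 'b set) \<Rightarrow> ('s \<Rightarrow> 's \<Rightarrow> 'b \<Rightarrow> real) \<Rightarrow> ('s \<Rightarrow> 'b \<Rightarrow> real)
    \<Rightarrow> real \<Rightarrow> 's \<Rightarrow> ennreal" where
  "opt_disc_cost A q c \<alpha> i = (INF \<pi>\<in>{\<pi>. markov_policy A \<pi>}. disc_cost A q c \<pi> \<alpha> i)"

(* h_alpha(i) = J*_alpha(i) - J*_alpha(i0) (J* finite under Assumptions A) *)
definition hdiff :: "('s \<Rightarrow> 'b set) \<Rightarrow> ('s \<Rightarrow> 's \<Rightarrow> 'b \<Rightarrow> real) \<Rightarrow> ('s \<Rightarrow> 'b \<Rightarrow> real)
    \<Rightarrow> 's \<Rightarrow> real \<Rightarrow> 's \<Rightarrow> real" where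
  "hdiff A q c i0 \<alpha> i = enn2real (opt_disc_cost A q c \<alpha> i) - enn2real (opt_disc_cost A q c \<alpha> i0)"

(* sum_j h(j) q(j|i,a), a value in (-infty, +infty] when h is bounded below;
   it is +infty exactly when the series is not (absolutely) summable *)
definition drift :: "('s \<Rightarrow> 's \<Rightarrow> 'b \<Rightarrow> real) \<Rightarrow> ('s \<Rightarrow> real) \<Rightarrow> 's \<Rightarrow> 'b \<Rightarrow> ereal" where
  "drift q h i a =
     (if (\<lambda>j. h j * q j i a) summable_on UNIV then ereal (\<Sum>\<^sub>\<infinity>j. h j * q j i a) else \<infinity>)"

definition st_rate :: "('s \<Rightarrow> 's \<Rightarrow> 'b \<Rightarrow> real) \<Rightarrow> ('s \<Rightarrow> 'b) \<Rightarrow> 's \<Rightarrow> real" where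
  "st_rate q e i = - q i i (e i)"

(* transition probabilities of the embedded jump chain (no jumps out of absorbing states) *)
definition jump_prob :: "('s \<Rightarrow> 's \<Rightarrow> 'b \<Rightarrow> real) \<Rightarrow> ('s \<Rightarrow> 'b) \<Rightarrow> 's \<Rightarrow> 's \<Rightarrow> real" where
  "jump_prob q e i j = (if j \<noteq> i \<and> 0 < st_rate q e i then q j i (e i) / st_rate q e i else 0)"

(* taboo probabilities: P_e(x_n = k, and x_1,...,x_n \<notin> G | x_0 = i) for the jump chain x_n *)
fun taboo :: "('s \<Rightarrow> 's \<Rightarrow> 'b \<Rightarrow> real) \<Rightarrow> ('s \<Rightarrow> 'b) \<Rightarrow> 's set \<Rightarrow> 's \<Rightarrow> nat \<Rightarrow> 's \<Rightarrow> ennreal" where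
  "taboo q e G i 0 k = (if k = i then 1 else 0)"
| "taboo q e G i (Suc n) k =
     (if k \<in> G then 0
      else \<integral>\<^sup>+ m. taboo q e G i n m * ennreal (jump_prob q e m k) \<partial>count_space UNIV)"

(* P_e(first passage to G happens at the (n+1)-th jump, landing in j | x(0) = i) *)
definition first_hit :: "('s \<Rightarrow> 's \<Rightarrow> 'b \<Rightarrow> real) \<Rightarrow> ('s \<Rightarrow> 'b) \<Rightarrow> 's set \<Rightarrow> 's \<Rightarrow> nat \<Rightarrow> 's \<Rightarrow> ennreal" where
  "first_hit q e G i n j =
     (if j \<in> G then \<integral>\<^sup>+ m. taboo q e G i n m * ennreal (jump_prob q e m j) \<partial>count_space UNIV else 0)"

definition hit_dist :: "('s \<Rightarrow> 's \<Rightarrow> 'b \<Rightarrow> real) \<Rightarrow> ('s \<Rightarrow> 'b) \<Rightarrow> 's set \<Rightarrow> 's \<Rightarrow> 's \<Rightarrow> ennreal" where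
  "hit_dist q e G i j = (\<Sum>n. first_hit q e G i n j)"

definition hit_prob :: "('s \<Rightarrow> 's \<Rightarrow> 'b \<Rightarrow> real) \<Rightarrow> ('s \<Rightarrow> 'b) \<Rightarrow> 's set \<Rightarrow> 's \<Rightarrow> ennreal" where
  "hit_prob q e G i = (\<integral>\<^sup>+ j. hit_dist q e G i j \<partial>count_space UNIV)"

(* m_{i,G}(e) = E_e[T | x(0) = i]: expected total holding time before the first passage
   (the holding time in state m is exponential with mean 1 / q_m(e(m))) *)
definition mean_passage :: "('s \<Rightarrow> 's \<Rightarrow> 'b \<Rightarrow> real) \<Rightarrow> ('s \<Rightarrow> 'b) \<Rightarrow> 's set \<Rightarrow> 's \<Rightarrow> ennreal" where
  "mean_passage q e G i =
     (\<Sum>n. \<integral>\<^sup>+ m. taboo q e G i n m * inverse (ennreal (st_rate q e m)) \<partial>count_space UNIV)"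

definition in_R :: "('s \<Rightarrow> 's \<Rightarrow> 'b \<Rightarrow> real) \<Rightarrow> ('s \<Rightarrow> 'b) \<Rightarrow> 's \<Rightarrow> 's set \<Rightarrow> bool" where
  "in_R q e i G \<longleftrightarrow> hit_prob q e G i = 1 \<and> mean_passage q e G i < \<infinity>"

(* positive recurrence of state i for the chain induced by e
   (absorbing states count as positive recurrent, as in Norris) *)
definition positive_recurrent :: "('s \<Rightarrow> 's \<Rightarrow> 'b \<Rightarrow> real) \<Rightarrow> ('s \<Rightarrow> 'b) \<Rightarrow> 's \<Rightarrow> bool" where
  "positive_recurrent q e i \<longleftrightarrow> st_rate q e i = 0 \<or> in_R q e i {i}"

end

theory Submission
  imports Defs
begin

text \<open>
  Conditioning on the first jump shows that the optimal discounted cost \<open>J\<^sub>\<alpha>\<close> is the increasing limit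
  of value iteration \<open>W\<^sub>n\<close> started at \<open>W\<^sub>0 = 0\<close>. Hence the Bellman inequality holds for the action
  \<open>e\<close>, and iterating it for \<open>W\<^sub>n\<close> along the jump chain up to the first passage \<open>T\<close> into \<open>G\<close> gives
  \[ J_\alpha(i) + \alpha\, E \int_0^T J_\alpha(x(t))\, dt \le E \int_0^T c\, dt + E\, J_\alpha(x(T)), \]
  with no remainder term because \<open>W\<^sub>0 = 0\<close>. Subtracting \<open>J\<^sub>\<alpha>(i\<^sub>0)\<close> and letting \<open>\<alpha> \<rightarrow> 0\<close>, with
  domination by \<open>H\<close>, yields \<open>h\<^sup>*(i) + g\<^sup>* E T \<le> E \<integral> c + E h\<^sup>*(x(T))\<close>. Iterating the defining equation
  of \<open>\<Phi>\<close> in the same way gives \<open>h\<^sup>*(i) + g\<^sup>* E T \<ge> E \<integral> (c + \<Phi>) + E h\<^sup>*(x(T))\<close>, so the expected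
  integral of \<open>\<Phi>\<close> before \<open>T\<close> vanishes; as the process spends positive time in \<open>i\<close>, \<open>\<Phi>(i) = 0\<close>.
  Condition (iv) and absorbing states need only the Bellman inequality at \<open>i\<close>.
\<close>

section \<open>Exponential clocks with time-dependent rate\<close>

text \<open>A countable sum is an integral over a sigma-finite discrete space, so measurability for
  each index is already joint measurability. This serves all the inner sums over states.\<close>

lemma borel_measurable_nn_integral_count_space:
  fixes f :: "'x \<Rightarrow> 's::countable \<Rightarrow> ennreal"
  assumes "\<And>k. k \<in> I \<Longrightarrow> (\<lambda>x. f x k) \<in> borel_measurable M"
  shows "(\<lambda>x. \<integral>\<^sup>+k. f x k \<partial>count_space I) \<in> borel_measurable M"
proof -
  interpret sigma_finite_measure "count_space I"
    by (rule sigma_finite_measure_count_space_countable) simp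
  have "(\<lambda>p. f (snd p) (fst p)) \<in> borel_measurable (count_space I \<Otimes>\<^sub>M M)"
    by (rule measurable_pair_measure_countable1) (use assms in auto)
  from measurable_compose[OF measurable_pair_swap' this]
  have "case_prod f \<in> borel_measurable (M \<Otimes>\<^sub>M count_space I)"
    by (simp add: case_prod_beta')
  then show ?thesis by (rule borel_measurable_nn_integral)
qed

lemma set_integrable_Icc_bounded:
  fixes f :: "real \<Rightarrow> real"
  assumes [measurable]: "f \<in> borel_measurable borel" and "\<And>x. x \<in> {a..b} \<Longrightarrow> \<bar>f x\<bar> \<le> B"
  shows "set_integrable lborel {a..b} f"
  unfolding set_integrable_def
  by (rule integrableI_bounded_set[where A="{a..b}" and B=B])
     (use assms(2) in \<open>auto simp: indicator_def emeasure_lborel_Icc_eq\<close>)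

lemma set_lebesgue_integral_Icc_bounded:
  fixes f :: "real \<Rightarrow> real"
  assumes "f \<in> borel_measurable borel" and "\<And>x. x \<in> {a..b} \<Longrightarrow> \<bar>f x\<bar> \<le> B"
  shows "f integrable_on {a..b}" "set_lebesgue_integral lborel {a..b} f = integral {a..b} f"
  using set_borel_integral_eq_integral[OF set_integrable_Icc_bounded[OF assms]] by auto

lemma borel_measurable_integral_Icc:
  fixes f :: "real \<Rightarrow> real"
  assumes [measurable]: "f \<in> borel_measurable borel" "a \<in> borel_measurable M" "b \<in> borel_measurable M"
  shows "(\<lambda>x. set_lebesgue_integral lborel {a x..b x} f) \<in> borel_measurable M"
proof -
  have "(\<lambda>x. set_lebesgue_integral lborel {a x..b x} f)
      = (\<lambda>x. LINT v|lborel. (if a x \<le> v \<and> v \<le> b x then f v else 0))"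
    unfolding set_lebesgue_integral_def
    by (intro ext Bochner_Integration.integral_cong) (auto simp: indicator_def)
  also have "\<dots> \<in> borel_measurable M" by measurable
  finally show ?thesis .
qed

text \<open>The difference quotient at \<open>u\<close> is at most
  \<open>K * \<bar>v - u\<bar>\<close>, so the derivative within \<open>{s..}\<close> exists and
  vanishes at every point.\<close>

lemma const_on_if_quadratic_increments:
  fixes F :: "real \<Rightarrow> real"
  assumes quad: "\<And>u v. s \<le> u \<Longrightarrow> u \<le> v \<Longrightarrow> \<bar>F v - F u\<bar> \<le> K * (v - u)\<^sup>2"
    and "s \<le> t"
  shows "F t = F s"
proof (rule has_derivative_zero_unique[of "{s..}" F t s])
  fix u assume u: "u \<in> {s..}"
  have K: "0 \<le> K" using quad[of s "s + 1"] by (simp add: order.trans[OF abs_ge_zero])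
  have "(F has_field_derivative 0) (at u within {s..})"
    unfolding has_field_derivative_iff
  proof (rule tendsto_rabs_zero_cancel, rule tendsto_sandwich[OF _ _ tendsto_const])
    show "\<forall>\<^sub>F v in at u within {s..}. 0 \<le> \<bar>(F v - F u) / (v - u)\<bar>" by simp
    have "\<bar>(F v - F u) / (v - u)\<bar> \<le> K * \<bar>v - u\<bar>" if "v \<in> {s..}" "v \<noteq> u" for v
    proof -
      have "\<bar>F v - F u\<bar> \<le> K * \<bar>v - u\<bar>\<^sup>2"
        using quad[of u v] quad[of v u] u that
        by (cases "u \<le> v") (auto simp: abs_minus_commute power2_commute)
      then show ?thesis using that
        by (simp add: abs_divide divide_le_eq power2_eq_square mult.assoc)
    qed
    then show "\<forall>\<^sub>F v in at u within {s..}. \<bar>(F v - F u) / (v - u)\<bar> \<le> K * \<bar>v - u\<bar>"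
      by (auto simp: eventually_at_filter)
    show "((\<lambda>v. K * \<bar>v - u\<bar>) \<longlongrightarrow> 0) (at u within {s..})"
      by (auto intro!: tendsto_eq_intros)
  qed
  then show "(F has_derivative (\<lambda>h. 0)) (at u within {s..})"
    by (rule has_derivative_eq_rhs[OF has_field_derivative_imp_has_derivative]) auto
qed (use \<open>s \<le> t\<close> in auto)

text \<open>The function \<open>exp (- \<Lambda> t) + \<integral>\<^sub>s\<^sup>t \<mu> exp (- \<Lambda>)\<close> has increments of second order, so it is
  constant; this replaces differentiating the absolutely continuous function \<open>exp (- \<Lambda>)\<close>.\<close>

lemma integral_hazard_density:
  fixes \<mu> :: "real \<Rightarrow> real"
  assumes [measurable]: "\<mu> \<in> borel_measurable borel"
    and bnd: "\<And>x. 0 \<le> \<mu> x" "\<And>x. \<mu> x \<le> M" and st: "s \<le> t"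
  defines "\<Lambda> \<equiv> \<lambda>t. integral {s..t} \<mu>"
  shows "(\<lambda>u. \<mu> u * exp (- \<Lambda> u)) integrable_on {s..t}"
    and "integral {s..t} (\<lambda>u. \<mu> u * exp (- \<Lambda> u)) = 1 - exp (- \<Lambda> t)"
proof -
  have int: "\<mu> integrable_on {a..b}" for a b
    by (rule set_lebesgue_integral_Icc_bounded(1)[where B=M]) (use bnd in auto)
  have M: "0 \<le> M" using bnd[of s] by simp
  have \<Lambda>_diff: "\<Lambda> v - \<Lambda> u = integral {u..v} \<mu>" if "s \<le> u" "u \<le> v" for u v
    unfolding \<Lambda>_def using Henstock_Kurzweil_Integration.integral_combine[OF that int] by simp
  have \<Lambda>_le: "0 \<le> \<Lambda> v - \<Lambda> u" "\<Lambda> v - \<Lambda> u \<le> M * (v - u)" if "s \<le> u" "u \<le> v" for u v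
  proof -
    show "0 \<le> \<Lambda> v - \<Lambda> u" unfolding \<Lambda>_diff[OF that]
      by (intro Henstock_Kurzweil_Integration.integral_nonneg int) (use bnd in auto)
    have "integral {u..v} \<mu> \<le> integral {u..v} (\<lambda>_. M)"
      by (intro integral_le int) (use bnd in auto)
    then show "\<Lambda> v - \<Lambda> u \<le> M * (v - u)" unfolding \<Lambda>_diff[OF that] using that by (simp add: mult.commute)
  qed
  have \<Lambda>_nonneg: "0 \<le> \<Lambda> u" for u
    unfolding \<Lambda>_def by (intro Henstock_Kurzweil_Integration.integral_nonneg int) (use bnd in auto)
  have \<Lambda>_leb: "set_lebesgue_integral lborel {s..u} \<mu> = \<Lambda> u" for u
    unfolding \<Lambda>_def
    by (rule set_lebesgue_integral_Icc_bounded(2)[where B=M]) (use bnd in auto)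
  have [measurable]: "\<Lambda> \<in> borel_measurable borel"
    unfolding \<Lambda>_leb[symmetric, abs_def] by (rule borel_measurable_integral_Icc) measurable
  define f where "f = (\<lambda>u. \<mu> u * exp (- \<Lambda> u))"
  have [measurable]: "f \<in> borel_measurable borel" unfolding f_def by measurable
  have fb: "0 \<le> f u" "f u \<le> M" for u
    using bnd[of u] \<Lambda>_nonneg[of u] M mult_mono[of "\<mu> u" M "exp (- \<Lambda> u)" 1] by (auto simp: f_def)
  have intf: "f integrable_on {a..b}" for a b
    by (rule set_lebesgue_integral_Icc_bounded(1)[where B=M]) (use fb in auto)
  define F where "F = (\<lambda>u. exp (- \<Lambda> u) + integral {s..u} f)"
  \<comment> \<open>With \<open>d\<close> the increase of \<open>\<Lambda>\<close> from
    \<open>u\<close> to \<open>v\<close>, monotonicity squeezes \<open>integral {u..v} f\<close>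
    between \<open>d * exp (- \<Lambda> v)\<close> and \<open>d * exp (- \<Lambda> u)\<close>.
    Either bound cancels the change of \<open>exp (- \<Lambda>)\<close> up to
    \<open>d\<^sup>2\<close>, and \<open>d\<close> is at most \<open>M * (v - u)\<close>.\<close>
  have "\<bar>F v - F u\<bar> \<le> M\<^sup>2 * (v - u)\<^sup>2" if uv: "s \<le> u" "u \<le> v" for u v
  proof -
    define d where "d = \<Lambda> v - \<Lambda> u"
    have d: "0 \<le> d" "d \<le> M * (v - u)" using \<Lambda>_le[OF uv] by (auto simp: d_def)
    have I: "F v - F u = exp (- \<Lambda> v) - exp (- \<Lambda> u) + integral {u..v} f"
      unfolding F_def using Henstock_Kurzweil_Integration.integral_combine[OF uv intf] by simp
    have "integral {u..v} f \<le> integral {u..v} (\<lambda>x. \<mu> x * exp (- \<Lambda> u))"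
      by (intro integral_le intf integrable_on_mult_left int)
         (use bnd \<Lambda>_le(1)[OF uv(1)] in \<open>auto simp: f_def intro!: mult_left_mono\<close>)
    then have up: "integral {u..v} f \<le> d * exp (- \<Lambda> u)"
      by (simp add: d_def \<Lambda>_diff[OF uv])
    have "integral {u..v} (\<lambda>x. \<mu> x * exp (- \<Lambda> v)) \<le> integral {u..v} f"
    proof (intro integral_le intf integrable_on_mult_left int)
      fix x assume x: "x \<in> {u..v}"
      show "\<mu> x * exp (- \<Lambda> v) \<le> f x"
        using bnd \<Lambda>_le(1)[of x v] uv x by (auto simp: f_def intro!: mult_left_mono)
    qed
    then have lo: "d * exp (- \<Lambda> v) \<le> integral {u..v} f"
      by (simp add: d_def \<Lambda>_diff[OF uv])
    have ev: "exp (- \<Lambda> v) = exp (- \<Lambda> u) * exp (- d)" by (simp add: d_def flip: exp_add)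
    have e1: "exp (- \<Lambda> u) \<le> 1" "0 \<le> exp (- \<Lambda> u)" using \<Lambda>_nonneg by auto
    have e2: "1 - d \<le> exp (- d)" using exp_ge_add_one_self[of "- d"] by simp
    have e3: "(1 + d) * exp (- d) \<le> 1"
      using mult_right_mono[OF exp_ge_add_one_self[of d], of "exp (- d)"] by (simp flip: exp_add)
    have "F v - F u \<le> exp (- \<Lambda> u) * (exp (- d) - 1 + d)"
      using up I ev by (simp add: algebra_simps)
    \<comment> \<open>The product \<open>(1 + d) * (1 - d + d\<^sup>2)\<close> equals
      \<open>1 + d ^ 3\<close>, while \<open>(1 + d) * exp (- d)\<close> is at most 1; dividing by
      \<open>1 + d\<close> bounds \<open>exp (- d)\<close>.\<close>
    also have "exp (- d) - 1 + d \<le> d\<^sup>2"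
    proof -
      have "exp (- d) \<le> 1 - d + d\<^sup>2"
      proof -
        have "1 \<le> (1 + d) * (1 - d + d\<^sup>2)" using d by (simp add: algebra_simps power2_eq_square)
        then have "(1 + d) * exp (- d) \<le> (1 + d) * (1 - d + d\<^sup>2)" using e3 by linarith
        then show ?thesis using d by (simp add: mult_le_cancel_left)
      qed
      then show ?thesis by simp
    qed
    then have "exp (- \<Lambda> u) * (exp (- d) - 1 + d) \<le> 1 * d\<^sup>2"
      using e1 e2 by (intro mult_mono) auto
    finally have A: "F v - F u \<le> d\<^sup>2" by simp
    have "F u - F v \<le> exp (- \<Lambda> u) * (1 - (1 + d) * exp (- d))"
      using lo I ev by (simp add: algebra_simps)
    also have "\<dots> \<le> 1 * d\<^sup>2"
    proof (rule mult_mono)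
      have "(1 + d) * (1 - d) \<le> (1 + d) * exp (- d)" using e2 d by (intro mult_left_mono) auto
      then show "1 - (1 + d) * exp (- d) \<le> d\<^sup>2" by (simp add: algebra_simps power2_eq_square)
    qed (use e1 e3 in auto)
    finally have B: "\<bar>F v - F u\<bar> \<le> d\<^sup>2" using A by simp
    have "d\<^sup>2 \<le> (M * (v - u))\<^sup>2" using d by (intro power_mono)
    then show ?thesis using B by (simp add: power_mult_distrib)
  qed
  from const_on_if_quadratic_increments[of s F "M\<^sup>2", OF this st]
  have "F t = F s" .
  then have "integral {s..t} f = 1 - exp (- \<Lambda> t)" by (simp add: F_def \<Lambda>_def)
  then show "integral {s..t} (\<lambda>u. \<mu> u * exp (- \<Lambda> u)) = 1 - exp (- \<Lambda> t)" by (simp add: f_def)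
  show "(\<lambda>u. \<mu> u * exp (- \<Lambda> u)) integrable_on {s..t}" using intf[of s t] by (simp add: f_def)
qed

text \<open>The integrand is the density of the first event when a clock with hazard
  \<open>\<rho>\<close> competes with an independent exponential clock of rate \<open>a\<close>. Its
  mass is 1 because the accumulated hazard is at least \<open>a * (u - s)\<close> and hence
  diverges.\<close>

lemma nn_integral_hazard_density:
  fixes \<rho> :: "real \<Rightarrow> real"
  assumes [measurable]: "\<rho> \<in> borel_measurable borel"
    and bnd: "\<And>x. 0 \<le> \<rho> x" "\<And>x. \<rho> x \<le> M" and a: "0 < a"
  shows "(\<integral>\<^sup>+u\<in>{s..}. ennreal (exp (- a * (u - s)) *
            exp (- set_lebesgue_integral lborel {s..u} \<rho>)) * ennreal (a + \<rho> u) \<partial>lborel) = 1"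
proof -
  define \<mu> where "\<mu> = (\<lambda>u. a + \<rho> u)"
  define \<Lambda> where "\<Lambda> = (\<lambda>t. integral {s..t} \<mu>)"
  have [measurable]: "\<mu> \<in> borel_measurable borel" unfolding \<mu>_def by measurable
  have \<mu>b: "0 \<le> \<mu> x" "\<mu> x \<le> a + M" for x using bnd a by (auto simp: \<mu>_def add_nonneg_nonneg less_imp_le)
  have l: "\<rho> integrable_on {s..u}" "set_lebesgue_integral lborel {s..u} \<rho> = integral {s..u} \<rho>" for u
    by (rule set_lebesgue_integral_Icc_bounded[where B=M]; use bnd in force)+
  have \<Lambda>_eq: "\<Lambda> u = a * (u - s) + set_lebesgue_integral lborel {s..u} \<rho>" if "s \<le> u" for u
    unfolding \<Lambda>_def \<mu>_def l using that
    by (subst Henstock_Kurzweil_Integration.integral_add) (auto intro: l)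
  have \<Lambda>_ge: "a * (u - s) \<le> \<Lambda> u" if "s \<le> u" for u
    unfolding \<Lambda>_eq[OF that] l using bnd
    by (simp add: Henstock_Kurzweil_Integration.integral_nonneg l)
  have \<Lambda>_leb: "set_lebesgue_integral lborel {s..u} \<mu> = \<Lambda> u" for u
    unfolding \<Lambda>_def
    by (rule set_lebesgue_integral_Icc_bounded(2)[where B="a + M"]) (use \<mu>b in auto)
  have [measurable]: "\<Lambda> \<in> borel_measurable borel"
    unfolding \<Lambda>_leb[symmetric, abs_def] by (rule borel_measurable_integral_Icc) measurable
  define f where "f = (\<lambda>u. \<mu> u * exp (- \<Lambda> u))"
  have [measurable]: "f \<in> borel_measurable borel" unfolding f_def by measurable
  have f0: "0 \<le> f u" for u using \<mu>b by (simp add: f_def)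
  have fin: "(\<integral>\<^sup>+u. ennreal (f u) * indicator {s..s + real n} u \<partial>lborel)
      = ennreal (1 - exp (- \<Lambda> (s + real n)))" for n
  proof -
    have "(f has_integral (1 - exp (- \<Lambda> (s + real n)))) {s..s + real n}"
      using integral_hazard_density[of \<mu> "a + M" s "s + real n"] \<mu>b
      unfolding f_def \<Lambda>_def by (auto simp: has_integral_iff)
    from nn_integral_has_integral_lborel[OF _ _ this[unfolded has_integral_restrict_UNIV[symmetric, where f=f]]]
    have "integral\<^sup>N lborel (\<lambda>x. if x \<in> {s..s + real n} then f x else 0)
      = ennreal (1 - exp (- \<Lambda> (s + real n)))" using f0 by auto
    moreover have "(\<integral>\<^sup>+u. ennreal (f u) * indicator {s..s + real n} u \<partial>lborel)
        = integral\<^sup>N lborel (\<lambda>x. if x \<in> {s..s + real n} then f x else 0)"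
      by (intro nn_integral_cong) (auto simp: indicator_def)
    ultimately show ?thesis by simp
  qed
  have "(\<integral>\<^sup>+u\<in>{s..}. ennreal (exp (- a * (u - s)) *
            exp (- set_lebesgue_integral lborel {s..u} \<rho>)) * ennreal (a + \<rho> u) \<partial>lborel)
      = (\<integral>\<^sup>+u. ennreal (f u) * indicator {s..} u \<partial>lborel)"
    by (intro nn_integral_cong)
       (auto simp: indicator_def f_def \<Lambda>_eq \<mu>_def ennreal_mult''[symmetric] mult.commute simp flip: exp_add)
  also have "\<dots> = (\<integral>\<^sup>+u. (SUP n. ennreal (f u) * indicator {s..s + real n} u) \<partial>lborel)"
  proof (intro nn_integral_cong)
    fix u :: real
    have "(SUP n. indicator {s..s + real n} u :: ennreal) = indicator {s..} u"
    proof (cases "s \<le> u")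
      case True
      obtain n where "u - s \<le> real n" using real_arch_simple by blast
      then have "indicator {s..s + real n} u = (1::ennreal)" using True by (simp add: indicator_def)
      then show ?thesis using True
        by (intro antisym SUP_least) (auto simp: indicator_def intro!: SUP_upper2[of n])
    qed (auto simp: indicator_def)
    then show "ennreal (f u) * indicator {s..} u = (SUP n. ennreal (f u) * indicator {s..s + real n} u)"
      by (simp add: SUP_mult_left_ennreal[symmetric])
  qed
  also have "\<dots> = (SUP n. ennreal (1 - exp (- \<Lambda> (s + real n))))"
    unfolding fin[symmetric]
    by (rule nn_integral_monotone_convergence_SUP)
       (auto simp: incseq_def le_fun_def indicator_def intro!: mult_left_mono)
  also have "\<dots> = 1"
  proof (rule antisym)
    show "(SUP n. ennreal (1 - exp (- \<Lambda> (s + real n)))) \<le> 1"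
      by (intro SUP_least) (metis ennreal_1 ennreal_leI diff_le_eq exp_ge_zero le_add_same_cancel1)
    have "(\<lambda>n. 1 - exp (- (a * real n))) \<longlonglongrightarrow> 1 - 0"
      using a by (intro tendsto_diff tendsto_const filterlim_compose[OF exp_at_bot])
        (auto simp: filterlim_uminus_at_bot intro!: filterlim_tendsto_pos_mult_at_top[OF tendsto_const] filterlim_real_sequentially)
    then have "(\<lambda>n. ennreal (1 - exp (- (a * real n)))) \<longlonglongrightarrow> ennreal 1"
      by (intro tendsto_ennrealI) simp
    moreover have "ennreal (1 - exp (- (a * real n))) \<le> (SUP n. ennreal (1 - exp (- \<Lambda> (s + real n))))" for n
      by (rule SUP_upper2[of n]) (use \<Lambda>_ge[of "s + real n"] in \<open>auto intro!: ennreal_leI\<close>)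
    ultimately show "1 \<le> (SUP n. ennreal (1 - exp (- \<Lambda> (s + real n))))"
      by (intro LIMSEQ_le_const2) auto
  qed
  finally show ?thesis .
qed

section \<open>Discounted cost by number of jumps\<close>

locale ctmdp =
  fixes A :: "'s::countable \<Rightarrow> 'b set"
    and q :: "'s \<Rightarrow> 's \<Rightarrow> 'b \<Rightarrow> real"
    and c :: "'s \<Rightarrow> 'b \<Rightarrow> real"
  assumes A_fin: "\<forall>i. finite (A i) \<and> A i \<noteq> {}"
    and q_cons: "conservative A q"
    and c_nonneg: "\<forall>i. \<forall>a\<in>A i. 0 \<le> c i a"
begin

lemma finite_actions [simp]: "finite (A i)" and actions_nonempty [simp]: "A i \<noteq> {}"
  using A_fin by auto

lemma q_nonneg: "a \<in> A i \<Longrightarrow> j \<noteq> i \<Longrightarrow> 0 \<le> q j i a"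
  using q_cons by (auto simp: conservative_def)

lemma q_off_diagonal_has_sum:
  assumes "a \<in> A i"
  shows "((\<lambda>j. q j i a) has_sum (- q i i a)) (UNIV - {i})"
proof -
  have "((\<lambda>j. q j i a) has_sum 0) UNIV" using q_cons assms by (auto simp: conservative_def)
  from has_sum_Diff[OF this has_sum_finite[of "{i}"]] show ?thesis by simp
qed

lemma q_diag_nonpos: "a \<in> A i \<Longrightarrow> q i i a \<le> 0"
  using has_sum_nonneg[OF q_off_diagonal_has_sum, of a i] q_nonneg[of a i] by auto

end

locale ctmdp_policy = ctmdp A q c
  for A :: "'s::countable \<Rightarrow> 'b set" and q c +
  fixes \<pi> :: "real \<Rightarrow> 's \<Rightarrow> 'b pmf" and \<alpha> :: real
  assumes policy: "markov_policy A \<pi>" and \<alpha>_pos: "0 < \<alpha>"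
begin

abbreviation "rate u j i \<equiv> pol_rate A q \<pi> u j i"
abbreviation "cost u i \<equiv> pol_cost A c \<pi> u i"
abbreviation "tr \<equiv> trans_n A q \<pi>"

text \<open>Discounting is read as killing at rate \<open>\<alpha>\<close>: this is the probability
  that by time \<open>u\<close> neither a jump out of \<open>i\<close> nor an independent killing
  has occurred.\<close>

definition weight :: "real \<Rightarrow> 's \<Rightarrow> real \<Rightarrow> ennreal" where
  "weight s i u = ennreal (exp (- \<alpha> * (u - s)) * exp (- out_int A q \<pi> i s u))"

text \<open>The discounted cost, seen from time \<open>s\<close>, incurred between the \<open>n\<close>-th and the next jump.\<close>

definition stage_cost :: "nat \<Rightarrow> real \<Rightarrow> 's \<Rightarrow> ennreal" where
  "stage_cost n s i = (\<integral>\<^sup>+t\<in>{s..}. ennreal (exp (- \<alpha> * (t - s))) *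
      (\<integral>\<^sup>+j. tr n s i t j * ennreal (cost t j) \<partial>count_space UNIV) \<partial>lborel)"

lemma measurable_rate [measurable]: "(\<lambda>u. rate u j i) \<in> borel_measurable borel"
  and measurable_cost [measurable]: "(\<lambda>u. cost u i) \<in> borel_measurable borel"
  using policy by (auto simp: pol_rate_def pol_cost_def markov_policy_def intro!: borel_measurable_sum borel_measurable_times)

lemma sum_pmf_actions: "(\<Sum>a\<in>A i. pmf (\<pi> u i) a) = 1"
  using policy by (intro sum_pmf_eq_1) (auto simp: markov_policy_def)

lemma rate_nonneg: "j \<noteq> i \<Longrightarrow> 0 \<le> rate u j i"
  unfolding pol_rate_def by (intro sum_nonneg mult_nonneg_nonneg) (auto intro: q_nonneg)

lemma cost_nonneg: "0 \<le> cost u i"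
  unfolding pol_cost_def using c_nonneg by (intro sum_nonneg mult_nonneg_nonneg) auto

text \<open>Finiteness of \<open>A i\<close> bounds the exit rate uniformly in time, so that the
  integral in \<open>out_int\<close> exists and is not a default value.\<close>

lemma exit_rate_bounds: "0 \<le> - rate u i i" "- rate u i i \<le> (\<Sum>a\<in>A i. - q i i a)"
proof -
  have eq: "- rate u i i = (\<Sum>a\<in>A i. pmf (\<pi> u i) a * (- q i i a))"
    by (simp add: pol_rate_def sum_negf)
  show "0 \<le> - rate u i i"
    unfolding eq by (intro sum_nonneg mult_nonneg_nonneg) (auto simp: q_diag_nonpos)
  show "- rate u i i \<le> (\<Sum>a\<in>A i. - q i i a)"
    unfolding eq
  proof (intro sum_mono)
    fix a assume "a \<in> A i"
    then show "pmf (\<pi> u i) a * - q i i a \<le> - q i i a"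
      using mult_right_mono[of "pmf (\<pi> u i) a" 1 "- q i i a"] by (simp add: pmf_le_1 q_diag_nonpos)
  qed
qed

lemma measurable_out_int [measurable (raw)]:
  assumes "f \<in> borel_measurable M" "g \<in> borel_measurable M"
  shows "(\<lambda>x. out_int A q \<pi> i (f x) (g x)) \<in> borel_measurable M"
  unfolding out_int_def using assms by (intro borel_measurable_integral_Icc) measurable

lemma measurable_weight [measurable (raw)]:
  assumes [measurable]: "f \<in> borel_measurable M" "g \<in> borel_measurable M"
  shows "(\<lambda>x. weight (f x) i (g x)) \<in> borel_measurable M"
  unfolding weight_def by measurable

text \<open>A jump or the killing occurs eventually with probability 1. This normalisation lets a
  constant be moved into and out of the time integral when costs are compared.\<close>

lemma weight_total: "(\<integral>\<^sup>+u\<in>{s..}. weight s i u * ennreal (\<alpha> - rate u i i) \<partial>lborel) = 1"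
  using nn_integral_hazard_density[of "\<lambda>u. - rate u i i" _ \<alpha> s, OF _ exit_rate_bounds \<alpha>_pos]
  unfolding weight_def out_int_def by simp

text \<open>The recursion restarts at the jump time \<open>u\<close> in another state, so the
  induction needs joint measurability in both times, for all starting states.\<close>

lemma measurable_trans_n_pair:
  "(\<lambda>p. tr n (fst p) i (snd p) j) \<in> borel_measurable (borel \<Otimes>\<^sub>M borel)"
proof (induction n arbitrary: i)
  case 0
  show ?case by (cases "i = j") simp_all
next
  case (Suc n)
  have [measurable]: "(\<lambda>x. \<integral>\<^sup>+k. ennreal (rate (snd x) k i) * tr n (snd x) k (snd (fst x)) j \<partial>count_space (UNIV - {i}))
      \<in> borel_measurable ((borel \<Otimes>\<^sub>M borel) \<Otimes>\<^sub>M lborel)"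
  proof (rule borel_measurable_nn_integral_count_space)
    fix k
    have "(\<lambda>x. tr n (snd x) k (snd (fst x)) j) \<in> borel_measurable ((borel \<Otimes>\<^sub>M borel) \<Otimes>\<^sub>M lborel)"
      using measurable_compose[OF _ Suc[of k], of "\<lambda>x. (snd x, snd (fst x))" "(borel \<Otimes>\<^sub>M borel) \<Otimes>\<^sub>M lborel"] by simp
    then show "(\<lambda>x. ennreal (rate (snd x) k i) * tr n (snd x) k (snd (fst x)) j)
        \<in> borel_measurable ((borel \<Otimes>\<^sub>M borel) \<Otimes>\<^sub>M lborel)"
      by measurable
  qed
  have "(\<lambda>p. tr (Suc n) (fst p) i (snd p) j) = (\<lambda>p. \<integral>\<^sup>+u. (if fst p \<le> u \<and> u \<le> snd p then
      ennreal (exp (- out_int A q \<pi> i (fst p) u)) *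
        (\<integral>\<^sup>+k. ennreal (rate u k i) * tr n u k (snd p) j \<partial>count_space (UNIV - {i})) else 0) \<partial>lborel)"
    by (intro ext) (auto intro!: nn_integral_cong simp: indicator_def)
  also have "\<dots> \<in> borel_measurable (borel \<Otimes>\<^sub>M borel)"
    by (rule lborel.borel_measurable_nn_integral) (simp add: case_prod_beta')
  finally show ?case .
qed

lemma measurable_trans_n [measurable (raw)]:
  assumes "f \<in> borel_measurable M" "g \<in> borel_measurable M"
  shows "(\<lambda>x. tr n (f x) i (g x) j) \<in> borel_measurable M"
  using measurable_compose[OF measurable_Pair[OF assms] measurable_trans_n_pair] by simp

lemma measurable_stage_cost [measurable]: "(\<lambda>s. stage_cost n s i) \<in> borel_measurable borel"
proof -
  have [measurable]: "(\<lambda>x. \<integral>\<^sup>+j. tr n (fst x) i (snd x) j * ennreal (cost (snd x) j) \<partial>count_space UNIV)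
      \<in> borel_measurable (borel \<Otimes>\<^sub>M lborel)"
    by (rule borel_measurable_nn_integral_count_space) measurable
  have "(\<lambda>s. stage_cost n s i) = (\<lambda>s. \<integral>\<^sup>+t. (if s \<le> t then ennreal (exp (- \<alpha> * (t - s))) *
      (\<integral>\<^sup>+j. tr n s i t j * ennreal (cost t j) \<partial>count_space UNIV) else 0) \<partial>lborel)"
    unfolding stage_cost_def by (intro ext) (auto intro!: nn_integral_cong simp: indicator_def)
  also have "\<dots> \<in> borel_measurable borel"
    by (rule lborel.borel_measurable_nn_integral) (simp add: case_prod_beta')
  finally show ?thesis .
qed

lemma stage_cost_0: "stage_cost 0 s i = (\<integral>\<^sup>+u\<in>{s..}. weight s i u * ennreal (cost u i) \<partial>lborel)"
proof -
  have "(\<integral>\<^sup>+j. tr 0 s i t j * ennreal (cost t j) \<partial>count_space UNIV)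
      = ennreal (exp (- out_int A q \<pi> i s t)) * ennreal (cost t i)" for t
    by (subst nn_integral_count_space'[of "{i}"]) auto
  then show ?thesis
    unfolding stage_cost_def weight_def by (simp add: ennreal_mult mult.assoc)
qed

text \<open>Conditioning on the first jump, at time \<open>u\<close> into state \<open>k\<close>:
  the recursion of \<open>trans_n\<close> is inserted, and Tonelli brings \<open>u\<close> and
  \<open>k\<close> outermost.\<close>

lemma stage_cost_Suc:
  "stage_cost (Suc n) s i = (\<integral>\<^sup>+u\<in>{s..}. weight s i u *
     (\<integral>\<^sup>+k. ennreal (rate u k i) * stage_cost n u k \<partial>count_space (UNIV - {i})) \<partial>lborel)"
proof -
  \<comment> \<open>The cut-off \<open>s \<le> u \<le> t\<close> sits inside \<open>F\<close>, so
    all four integrals run over fixed spaces and can be interchanged.\<close>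
  define F where "F u t j k = (if s \<le> u \<and> u \<le> t then ennreal (exp (- \<alpha> * (t - s))) *
    (ennreal (exp (- out_int A q \<pi> i s u)) * (ennreal (rate u k i) * tr n u k t j)) *
      ennreal (cost t j) else 0)" for u t j k
  let ?K = "count_space (UNIV - {i})"
  have F_meas: "(\<lambda>x. F (f x) (g x) j k) \<in> borel_measurable M"
    if [measurable]: "f \<in> borel_measurable M" "g \<in> borel_measurable M" for f g M j k
    unfolding F_def by measurable
  have K_meas: "(\<lambda>x. \<integral>\<^sup>+k. F (f x) (g x) j k \<partial>?K) \<in> borel_measurable M"
    if "f \<in> borel_measurable M" "g \<in> borel_measurable M" for f g M j
    using that by (intro borel_measurable_nn_integral_count_space F_meas)
  have J_meas: "(\<lambda>x. \<integral>\<^sup>+j. F (f x) (g x) j k \<partial>count_space UNIV) \<in> borel_measurable M"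
    if "f \<in> borel_measurable M" "g \<in> borel_measurable M" for f g M k
    using that by (intro borel_measurable_nn_integral_count_space F_meas)
  have JK_meas: "(\<lambda>x. \<integral>\<^sup>+j. \<integral>\<^sup>+k. F (f x) (g x) j k \<partial>?K \<partial>count_space UNIV) \<in> borel_measurable M"
    if "f \<in> borel_measurable M" "g \<in> borel_measurable M" for f g M
    using that by (intro borel_measurable_nn_integral_count_space K_meas)
  have inner: "indicator {s..} t * (ennreal (exp (- \<alpha> * (t - s))) * (tr (Suc n) s i t j * ennreal (cost t j)))
      = (\<integral>\<^sup>+u. \<integral>\<^sup>+k. F u t j k \<partial>?K \<partial>lborel)" for t j
  proof -
    have [measurable]: "(\<lambda>u. \<integral>\<^sup>+k. ennreal (rate u k i) * tr n u k t j \<partial>?K) \<in> borel_measurable borel"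
      by (rule borel_measurable_nn_integral_count_space) measurable
    have "indicator {s..} t * (ennreal (exp (- \<alpha> * (t - s))) * (tr (Suc n) s i t j * ennreal (cost t j)))
      = (\<integral>\<^sup>+u. indicator {s..} t * (ennreal (exp (- \<alpha> * (t - s))) * (ennreal (exp (- out_int A q \<pi> i s u)) *
        (\<integral>\<^sup>+k. ennreal (rate u k i) * tr n u k t j \<partial>?K) * indicator {s..t} u * ennreal (cost t j))) \<partial>lborel)"
      by (simp add: nn_integral_cmult nn_integral_multc)
    also have "\<dots> = (\<integral>\<^sup>+u. \<integral>\<^sup>+k. F u t j k \<partial>?K \<partial>lborel)"
      unfolding F_def
      by (intro nn_integral_cong)
         (auto simp: indicator_def nn_integral_cmult nn_integral_multc, simp add: mult.assoc)
    finally show ?thesis .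
  qed
  \<comment> \<open>With \<open>u\<close> and \<open>k\<close> fixed, the discount factor splits at
    \<open>u\<close>: one part joins the weight, the other makes the rest a stage cost started
    afresh at time \<open>u\<close>.\<close>
  have outer: "(\<integral>\<^sup>+t. \<integral>\<^sup>+j. F u t j k \<partial>count_space UNIV \<partial>lborel)
      = indicator {s..} u * (weight s i u * (ennreal (rate u k i) * stage_cost n u k))" for u k
  proof -
    have [measurable]: "(\<lambda>t. \<integral>\<^sup>+j. tr n u k t j * ennreal (cost t j) \<partial>count_space UNIV) \<in> borel_measurable borel"
      by (rule borel_measurable_nn_integral_count_space) measurable
    have F_eq: "F u t j k = indicator {s..} u * (weight s i u * (ennreal (rate u k i) *
       (ennreal (exp (- \<alpha> * (t - u))) * (tr n u k t j * ennreal (cost t j)) * indicator {u..} t)))" for t j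
    proof -
      have "ennreal (exp (- \<alpha> * (t - s))) = ennreal (exp (- \<alpha> * (u - s))) * ennreal (exp (- \<alpha> * (t - u)))"
        by (simp add: algebra_simps flip: ennreal_mult exp_add)
      then show ?thesis
        by (auto simp: F_def weight_def indicator_def ennreal_mult ac_simps)
    qed
    show ?thesis
      unfolding F_eq stage_cost_def
      by (simp add: nn_integral_cmult nn_integral_multc)
  qed
  have "stage_cost (Suc n) s i = (\<integral>\<^sup>+t. \<integral>\<^sup>+j. indicator {s..} t * (ennreal (exp (- \<alpha> * (t - s))) *
      (tr (Suc n) s i t j * ennreal (cost t j))) \<partial>count_space UNIV \<partial>lborel)"
    unfolding stage_cost_def
    by (simp add: nn_integral_cmult mult.commute[of _ "indicator _ _"] del: trans_n.simps)
  also have "\<dots> = (\<integral>\<^sup>+t. \<integral>\<^sup>+j. \<integral>\<^sup>+u. \<integral>\<^sup>+k. F u t j k \<partial>?K \<partial>lborel \<partial>count_space UNIV \<partial>lborel)"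
    unfolding inner ..
  \<comment> \<open>The nesting goes from \<open>t j u k\<close> to \<open>u k t j\<close> in four
    swaps. Only the exchange of \<open>t\<close> and \<open>u\<close> involves two Lebesgue
    integrals; the others have a countable sum on at least one side.\<close>
  also have "\<dots> = (\<integral>\<^sup>+t. \<integral>\<^sup>+u. \<integral>\<^sup>+j. \<integral>\<^sup>+k. F u t j k \<partial>?K \<partial>count_space UNIV \<partial>lborel \<partial>lborel)"
    by (intro nn_integral_cong nn_integral_count_space_nn_integral[symmetric] K_meas) auto
  also have "\<dots> = (\<integral>\<^sup>+u. \<integral>\<^sup>+t. \<integral>\<^sup>+j. \<integral>\<^sup>+k. F u t j k \<partial>?K \<partial>count_space UNIV \<partial>lborel \<partial>lborel)"
    by (rule lborel_pair.Fubini') (auto simp: case_prod_beta' intro!: JK_meas)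
  also have "\<dots> = (\<integral>\<^sup>+u. \<integral>\<^sup>+t. \<integral>\<^sup>+k. \<integral>\<^sup>+j. F u t j k \<partial>count_space UNIV \<partial>?K \<partial>lborel \<partial>lborel)"
    by (intro nn_integral_cong nn_integral_count_space_nn_integral) auto
  also have "\<dots> = (\<integral>\<^sup>+u. \<integral>\<^sup>+k. \<integral>\<^sup>+t. \<integral>\<^sup>+j. F u t j k \<partial>count_space UNIV \<partial>lborel \<partial>?K \<partial>lborel)"
    by (intro nn_integral_cong nn_integral_count_space_nn_integral J_meas) auto
  also have "\<dots> = (\<integral>\<^sup>+u\<in>{s..}. weight s i u *
     (\<integral>\<^sup>+k. ennreal (rate u k i) * stage_cost n u k \<partial>?K) \<partial>lborel)"
    unfolding outer by (simp add: nn_integral_cmult mult.commute[of _ "indicator _ _"])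
  finally show ?thesis .
qed

text \<open>The cost before the first jump is added to \<open>N\<close> stages seen from the state
  after it. This is the counterpart, for a fixed policy, of one step of value iteration.\<close>

lemma sum_stage_cost_Suc:
  "(\<Sum>n<Suc N. stage_cost n s i) = (\<integral>\<^sup>+u\<in>{s..}. weight s i u * (ennreal (cost u i) +
     (\<integral>\<^sup>+k. ennreal (rate u k i) * (\<Sum>n<N. stage_cost n u k) \<partial>count_space (UNIV - {i}))) \<partial>lborel)"
proof -
  let ?K = "count_space (UNIV - {i})"
  have [measurable]: "(\<lambda>u. \<integral>\<^sup>+k. ennreal (rate u k i) * stage_cost n u k \<partial>?K) \<in> borel_measurable borel" for n
    by (rule borel_measurable_nn_integral_count_space) measurable
  have "(\<Sum>n<Suc N. stage_cost n s i) = stage_cost 0 s i + (\<Sum>n<N. stage_cost (Suc n) s i)"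
    by (rule sum.lessThan_Suc_shift)
  also have "(\<Sum>n<N. stage_cost (Suc n) s i) = (\<integral>\<^sup>+u. (\<Sum>n<N. weight s i u *
     (\<integral>\<^sup>+k. ennreal (rate u k i) * stage_cost n u k \<partial>?K) * indicator {s..} u) \<partial>lborel)"
    unfolding stage_cost_Suc by (rule nn_integral_sum[symmetric]) measurable
  also have "stage_cost 0 s i + \<dots> = (\<integral>\<^sup>+u. weight s i u * ennreal (cost u i) * indicator {s..} u + (\<Sum>n<N. weight s i u *
     (\<integral>\<^sup>+k. ennreal (rate u k i) * stage_cost n u k \<partial>?K) * indicator {s..} u) \<partial>lborel)"
    unfolding stage_cost_0 by (rule nn_integral_add[symmetric]) measurable
  also have "\<dots> = (\<integral>\<^sup>+u\<in>{s..}. weight s i u * (ennreal (cost u i) +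
     (\<integral>\<^sup>+k. ennreal (rate u k i) * (\<Sum>n<N. stage_cost n u k) \<partial>?K)) \<partial>lborel)"
    by (intro nn_integral_cong)
       (simp add: sum_distrib_left nn_integral_sum distrib_left distrib_right sum_distrib_right)
  finally show ?thesis .
qed

lemma disc_cost_eq_SUP: "disc_cost A q c \<pi> \<alpha> i = (SUP N. \<Sum>n<N. stage_cost n 0 i)"
proof -
  have [measurable]: "(\<lambda>t. \<integral>\<^sup>+j. tr n 0 i t j * ennreal (cost t j) \<partial>count_space UNIV) \<in> borel_measurable borel" for n
    by (rule borel_measurable_nn_integral_count_space) measurable
  have "(\<integral>\<^sup>+j. (\<Sum>n. tr n 0 i t j) * ennreal (cost t j) \<partial>count_space UNIV)
      = (\<Sum>n. \<integral>\<^sup>+j. tr n 0 i t j * ennreal (cost t j) \<partial>count_space UNIV)" for t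
    unfolding ennreal_suminf_multc[symmetric] by (rule nn_integral_suminf) simp
  then have "disc_cost A q c \<pi> \<alpha> i = (\<integral>\<^sup>+t. (\<Sum>n. ennreal (exp (- \<alpha> * (t - 0))) *
      (\<integral>\<^sup>+j. tr n 0 i t j * ennreal (cost t j) \<partial>count_space UNIV) * indicator {0..} t) \<partial>lborel)"
    unfolding disc_cost_def trans_fun_def
    by (simp add: ennreal_suminf_multc ennreal_suminf_cmult)
  also have "\<dots> = (\<Sum>n. stage_cost n 0 i)"
    unfolding stage_cost_def by (rule nn_integral_suminf) measurable
  finally show ?thesis by (simp add: suminf_eq_SUP)
qed

end

section \<open>Value iteration\<close>

lemma ennreal_times_divide_cancel:
  "0 < d \<Longrightarrow> ennreal d * (x / ennreal d) = x"
  using ennreal_mult_divide_eq[of "ennreal d" x] by (simp add: ennreal_times_divide mult.commute)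

context ctmdp
begin

text \<open>The diagonal rate is left out and appears as the factor
  \<open>\<alpha> - q i i a\<close> on the other side of the optimality inequality. All terms are
  then nonnegative and values may be infinite.\<close>

definition bellman :: "('s \<Rightarrow> ennreal) \<Rightarrow> 's \<Rightarrow> 'b \<Rightarrow> ennreal" where
  "bellman V i a = ennreal (c i a) + (\<integral>\<^sup>+k. ennreal (q k i a) * V k \<partial>count_space (UNIV - {i}))"

text \<open>Value iteration in jump-chain form: \<open>\<alpha> - q i i a\<close> is the total rate
  of killing and leaving \<open>i\<close>, its inverse is the mean discounted sojourn time, and
  \<open>n\<close> counts the sojourns that are charged.\<close>

primrec value_iter :: "real \<Rightarrow> nat \<Rightarrow> 's \<Rightarrow> ennreal" where
  "value_iter \<alpha> 0 = (\<lambda>i. 0)"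
| "value_iter \<alpha> (Suc n) = (\<lambda>i. MIN a\<in>A i. bellman (value_iter \<alpha> n) i a / ennreal (\<alpha> - q i i a))"

lemma bellman_mono: "(\<And>k. V k \<le> W k) \<Longrightarrow> bellman V i a \<le> bellman W i a"
  unfolding bellman_def by (intro add_mono nn_integral_mono mult_left_mono) auto

lemma bellman_SUP:
  assumes "incseq V"
  shows "bellman (\<lambda>k. SUP n. V n k) i a = (SUP n. bellman (V n) i a)"
proof -
  have "(\<integral>\<^sup>+k. ennreal (q k i a) * (SUP n. V n k) \<partial>count_space (UNIV - {i}))
      = (SUP n. \<integral>\<^sup>+k. ennreal (q k i a) * V n k \<partial>count_space (UNIV - {i}))"
    unfolding SUP_mult_left_ennreal
    by (rule nn_integral_monotone_convergence_SUP)
       (use assms in \<open>auto simp: incseq_def le_fun_def intro!: mult_left_mono\<close>)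
  then show ?thesis
    unfolding bellman_def by (simp add: ennreal_SUP_add_right)
qed

context
  fixes \<alpha> :: real
  assumes \<alpha>_pos: "0 < \<alpha>"
begin

lemma discounted_rate_pos: "a \<in> A i \<Longrightarrow> 0 < \<alpha> - q i i a"
  using q_diag_nonpos[of a i] \<alpha>_pos by simp

lemma value_iter_Suc_le:
  assumes "a \<in> A i"
  shows "ennreal (\<alpha> - q i i a) * value_iter \<alpha> (Suc n) i \<le> bellman (value_iter \<alpha> n) i a"
proof -
  have "value_iter \<alpha> (Suc n) i \<le> bellman (value_iter \<alpha> n) i a / ennreal (\<alpha> - q i i a)"
    using assms by (auto intro!: Min_le)
  from mult_left_mono[OF this, of "ennreal (\<alpha> - q i i a)"] show ?thesis
    unfolding ennreal_times_divide_cancel[OF discounted_rate_pos[OF assms]] by simp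
qed

lemma value_iter_Suc_attained:
  obtains a where "a \<in> A i"
    "value_iter \<alpha> (Suc n) i = bellman (value_iter \<alpha> n) i a / ennreal (\<alpha> - q i i a)"
    "ennreal (\<alpha> - q i i a) * value_iter \<alpha> (Suc n) i = bellman (value_iter \<alpha> n) i a"
proof -
  have "value_iter \<alpha> (Suc n) i \<in> (\<lambda>a. bellman (value_iter \<alpha> n) i a / ennreal (\<alpha> - q i i a)) ` A i"
    unfolding value_iter.simps by (rule Min_in) auto
  then obtain a where a: "a \<in> A i"
    "value_iter \<alpha> (Suc n) i = bellman (value_iter \<alpha> n) i a / ennreal (\<alpha> - q i i a)"
    by blast
  then show ?thesis
    using that[OF a] by (simp only: ennreal_times_divide_cancel discounted_rate_pos)
qed

lemma incseq_value_iter: "incseq (value_iter \<alpha>)"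
proof (rule incseq_SucI, rule le_funI)
  fix n i
  show "value_iter \<alpha> n i \<le> value_iter \<alpha> (Suc n) i"
  proof (induction n arbitrary: i)
    case 0
    show ?case by simp
  next
    case (Suc n)
    obtain a where a: "a \<in> A i"
      "value_iter \<alpha> (Suc (Suc n)) i = bellman (value_iter \<alpha> (Suc n)) i a / ennreal (\<alpha> - q i i a)"
      by (rule value_iter_Suc_attained)
    have "value_iter \<alpha> (Suc n) i \<le> bellman (value_iter \<alpha> n) i a / ennreal (\<alpha> - q i i a)"
      using a(1) by (auto intro!: Min_le)
    also have "\<dots> \<le> value_iter \<alpha> (Suc (Suc n)) i"
      unfolding a(2) by (intro divide_right_mono_ennreal bellman_mono Suc)
    finally show ?case .
  qed
qed

text \<open>Limit and minimum interchange because \<open>A i\<close> is finite. If every action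
  violated the inequality, each would do so at a finite stage and, by monotonicity, all of them at
  the largest such stage, which the minimising action there contradicts.\<close>

lemma SUP_value_iter_attained:
  defines "V \<equiv> \<lambda>i. SUP n. value_iter \<alpha> n i"
  shows "\<exists>a\<in>A i. bellman V i a \<le> ennreal (\<alpha> - q i i a) * V i"
proof (rule ccontr)
  assume "\<not> ?thesis"
  then have "\<forall>a\<in>A i. ennreal (\<alpha> - q i i a) * V i < bellman V i a"
    by (simp add: not_le)
  then have "\<forall>a\<in>A i. \<exists>n. ennreal (\<alpha> - q i i a) * V i < bellman (value_iter \<alpha> n) i a"
    unfolding V_def bellman_SUP[OF incseq_value_iter] by (simp add: less_SUP_iff)
  then obtain n where n: "\<And>a. a \<in> A i \<Longrightarrow> ennreal (\<alpha> - q i i a) * V i < bellman (value_iter \<alpha> (n a)) i a"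
    by metis
  define N where "N = Max (n ` A i)"
  obtain a where a: "a \<in> A i"
    "ennreal (\<alpha> - q i i a) * value_iter \<alpha> (Suc N) i = bellman (value_iter \<alpha> N) i a"
    by (rule value_iter_Suc_attained)
  have "ennreal (\<alpha> - q i i a) * V i < bellman (value_iter \<alpha> (n a)) i a"
    by (rule n[OF a(1)])
  also have "\<dots> \<le> bellman (value_iter \<alpha> N) i a"
    using incseqD[OF incseq_value_iter, of "n a" N] a(1)
    by (intro bellman_mono) (auto simp: N_def le_fun_def)
  also have "\<dots> \<le> ennreal (\<alpha> - q i i a) * V i"
    unfolding a(2)[symmetric] V_def by (intro mult_left_mono SUP_upper) auto
  finally show False by simp
qed

end

end

section \<open>Value iteration against an arbitrary policy\<close>

context ctmdp_policy
begin

lemma bellman_average: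
  "ennreal (cost u i) + (\<integral>\<^sup>+k. ennreal (rate u k i) * W k \<partial>count_space (UNIV - {i}))
     = (\<Sum>a\<in>A i. ennreal (pmf (\<pi> u i) a) * bellman W i a)"
proof -
  have 1: "ennreal (cost u i) = (\<Sum>a\<in>A i. ennreal (pmf (\<pi> u i) a) * ennreal (c i a))"
    unfolding pol_cost_def using c_nonneg by (simp add: ennreal_mult' flip: sum_ennreal)
  have "ennreal (rate u k i) = (\<Sum>a\<in>A i. ennreal (pmf (\<pi> u i) a) * ennreal (q k i a))" if "k \<noteq> i" for k
    unfolding pol_rate_def using that by (simp add: ennreal_mult' q_nonneg flip: sum_ennreal)
  then have "(\<integral>\<^sup>+k. ennreal (rate u k i) * W k \<partial>count_space (UNIV - {i}))
      = (\<integral>\<^sup>+k. (\<Sum>a\<in>A i. ennreal (pmf (\<pi> u i) a) * (ennreal (q k i a) * W k)) \<partial>count_space (UNIV - {i}))"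
    by (intro nn_integral_cong) (simp add: sum_distrib_right mult.assoc)
  also have "\<dots> = (\<Sum>a\<in>A i. ennreal (pmf (\<pi> u i) a) *
      (\<integral>\<^sup>+k. ennreal (q k i a) * W k \<partial>count_space (UNIV - {i})))"
    by (simp add: nn_integral_sum nn_integral_cmult)
  finally show ?thesis
    unfolding 1 bellman_def by (simp add: distrib_left sum.distrib)
qed

lemma exit_rate_average:
  "ennreal (\<alpha> - rate u i i) = (\<Sum>a\<in>A i. ennreal (pmf (\<pi> u i) a) * ennreal (\<alpha> - q i i a))"
proof -
  have "\<alpha> - rate u i i = (\<Sum>a\<in>A i. pmf (\<pi> u i) a * (\<alpha> - q i i a))"
    unfolding pol_rate_def right_diff_distrib sum_subtractf sum_distrib_right[symmetric] sum_pmf_actions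
    by simp
  then show ?thesis
    using discounted_rate_pos[OF \<alpha>_pos] by (simp add: ennreal_mult' less_imp_le flip: sum_ennreal)
qed

text \<open>Induction on the number of stages: averaging over actions cannot fall below the minimum
  in \<open>value_iter\<close>. The time \<open>s\<close> is arbitrary because the induction
  hypothesis is applied at the jump time \<open>u\<close>.\<close>

lemma value_iter_le_sum_stage_cost: "value_iter \<alpha> N i \<le> (\<Sum>n<N. stage_cost n s i)"
proof (induction N arbitrary: s i)
  case 0
  show ?case by simp
next
  case (Suc N)
  let ?v = "value_iter \<alpha> (Suc N) i"
  have "?v = (\<integral>\<^sup>+u\<in>{s..}. weight s i u * ennreal (\<alpha> - rate u i i) \<partial>lborel) * ?v"
    by (simp only: weight_total mult_1)
  also have "\<dots> = (\<integral>\<^sup>+u. weight s i u * ennreal (\<alpha> - rate u i i) * indicator {s..} u * ?v \<partial>lborel)"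
    by (rule nn_integral_multc[symmetric]) measurable
  also have "\<dots> \<le> (\<integral>\<^sup>+u\<in>{s..}. weight s i u * (ennreal (cost u i) +
     (\<integral>\<^sup>+k. ennreal (rate u k i) * (\<Sum>n<N. stage_cost n u k) \<partial>count_space (UNIV - {i}))) \<partial>lborel)"
  proof (rule nn_integral_mono)
    fix u
    have "ennreal (\<alpha> - rate u i i) * ?v = (\<Sum>a\<in>A i. ennreal (pmf (\<pi> u i) a) * (ennreal (\<alpha> - q i i a) * ?v))"
      unfolding exit_rate_average by (simp only: sum_distrib_right mult.assoc)
    also have "\<dots> \<le> (\<Sum>a\<in>A i. ennreal (pmf (\<pi> u i) a) * bellman (value_iter \<alpha> N) i a)"
      by (intro sum_mono mult_left_mono value_iter_Suc_le[OF \<alpha>_pos]) auto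
    also have "\<dots> \<le> (\<Sum>a\<in>A i. ennreal (pmf (\<pi> u i) a) * bellman (\<lambda>k. \<Sum>n<N. stage_cost n u k) i a)"
      by (intro sum_mono mult_left_mono bellman_mono Suc) auto
    finally have "ennreal (\<alpha> - rate u i i) * ?v \<le> ennreal (cost u i) +
        (\<integral>\<^sup>+k. ennreal (rate u k i) * (\<Sum>n<N. stage_cost n u k) \<partial>count_space (UNIV - {i}))"
      unfolding bellman_average .
    from mult_left_mono[OF this, of "weight s i u * indicator {s..} u"]
    show "weight s i u * ennreal (\<alpha> - rate u i i) * indicator {s..} u * ?v \<le> weight s i u * (ennreal (cost u i) +
        (\<integral>\<^sup>+k. ennreal (rate u k i) * (\<Sum>n<N. stage_cost n u k) \<partial>count_space (UNIV - {i}))) * indicator {s..} u"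
      by (simp only: mult_ac) simp
  qed
  also have "\<dots> = (\<Sum>n<Suc N. stage_cost n s i)"
    by (rule sum_stage_cost_Suc[symmetric])
  finally show ?case .
qed

end

section \<open>The optimal discounted cost as limit of value iteration\<close>

context ctmdp
begin

text \<open>The limit is a lower bound for every policy. It is attained by the stationary policy
  that picks in each state an action satisfying the Bellman inequality for the limit: its truncated
  costs start at 0 and stay below the limit by induction.\<close>

lemma opt_disc_cost_eq_SUP_value_iter:
  assumes \<alpha>: "0 < \<alpha>"
  shows "opt_disc_cost A q c \<alpha> i = (SUP n. value_iter \<alpha> n i)"
proof (rule antisym)
  define V where "V i = (SUP n. value_iter \<alpha> n i)" for i
  have "\<exists>a. a \<in> A i \<and> bellman V i a \<le> ennreal (\<alpha> - q i i a) * V i" for i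
    using SUP_value_iter_attained[OF \<alpha>, of i] unfolding V_def by blast
  then obtain f where f: "\<And>i. f i \<in> A i" "\<And>i. bellman V i (f i) \<le> ennreal (\<alpha> - q i i (f i)) * V i"
    by metis
  define \<pi> :: "real \<Rightarrow> 's \<Rightarrow> 'b pmf" where "\<pi> u i = return_pmf (f i)" for u i
  interpret ctmdp_policy A q c \<pi> \<alpha>
    by unfold_locales (use f \<alpha> in \<open>auto simp: markov_policy_def \<pi>_def\<close>)
  have pmf: "ennreal (pmf (\<pi> u i) a) = (if a = f i then 1 else 0)" for u i a
    by (auto simp: \<pi>_def indicator_def)
  have "(\<Sum>n<N. stage_cost n s i) \<le> V i" for N s i
  proof (induction N arbitrary: s i)
    case 0
    show ?case by simp
  next
    case (Suc N)
    have "(\<Sum>n<Suc N. stage_cost n s i) \<le> (\<integral>\<^sup>+u. weight s i u * ennreal (\<alpha> - rate u i i) * indicator {s..} u * V i \<partial>lborel)"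
      unfolding sum_stage_cost_Suc
    proof (rule nn_integral_mono)
      fix u
      have "ennreal (cost u i) +
        (\<integral>\<^sup>+k. ennreal (rate u k i) * (\<Sum>n<N. stage_cost n u k) \<partial>count_space (UNIV - {i}))
         = bellman (\<lambda>k. \<Sum>n<N. stage_cost n u k) i (f i)"
        unfolding bellman_average pmf using f(1)[of i] by (simp add: if_distrib[of "\<lambda>x. x * _"] cong: if_cong)
      also have "\<dots> \<le> bellman V i (f i)" by (intro bellman_mono Suc)
      also have "\<dots> \<le> ennreal (\<alpha> - q i i (f i)) * V i" by (rule f)
      also have "ennreal (\<alpha> - q i i (f i)) = ennreal (\<alpha> - rate u i i)"
        unfolding exit_rate_average pmf using f(1)[of i] by (simp add: if_distrib[of "\<lambda>x. x * _"] cong: if_cong)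
      finally have "ennreal (cost u i) +
        (\<integral>\<^sup>+k. ennreal (rate u k i) * (\<Sum>n<N. stage_cost n u k) \<partial>count_space (UNIV - {i}))
         \<le> ennreal (\<alpha> - rate u i i) * V i" .
      from mult_left_mono[OF this, of "weight s i u * indicator {s..} u"]
      show "weight s i u * (ennreal (cost u i) +
        (\<integral>\<^sup>+k. ennreal (rate u k i) * (\<Sum>n<N. stage_cost n u k) \<partial>count_space (UNIV - {i}))) * indicator {s..} u
         \<le> weight s i u * ennreal (\<alpha> - rate u i i) * indicator {s..} u * V i"
        by (simp only: mult_ac) simp
    qed
    also have "\<dots> = (\<integral>\<^sup>+u\<in>{s..}. weight s i u * ennreal (\<alpha> - rate u i i) \<partial>lborel) * V i"
      by (rule nn_integral_multc) measurable
    also have "\<dots> = V i" by (simp only: weight_total mult_1)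
    finally show ?case .
  qed
  then have "disc_cost A q c \<pi> \<alpha> i \<le> V i"
    unfolding disc_cost_eq_SUP by (intro SUP_least)
  then show "opt_disc_cost A q c \<alpha> i \<le> (SUP n. value_iter \<alpha> n i)"
    unfolding opt_disc_cost_def V_def using policy by (intro INF_lower2[of \<pi>]) auto
next
  show "(SUP n. value_iter \<alpha> n i) \<le> opt_disc_cost A q c \<alpha> i"
    unfolding opt_disc_cost_def
  proof (rule INF_greatest)
    fix \<pi> assume "\<pi> \<in> {\<pi>. markov_policy A \<pi>}"
    then interpret ctmdp_policy A q c \<pi> \<alpha>
      by unfold_locales (use \<alpha> in auto)
    show "(SUP n. value_iter \<alpha> n i) \<le> disc_cost A q c \<pi> \<alpha> i"
      unfolding disc_cost_eq_SUP by (intro SUP_mono) (use value_iter_le_sum_stage_cost in blast)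
  qed
qed

lemma opt_disc_cost_le_bellman:
  assumes \<alpha>: "0 < \<alpha>" and a: "a \<in> A i"
  shows "ennreal (\<alpha> - q i i a) * opt_disc_cost A q c \<alpha> i \<le> bellman (opt_disc_cost A q c \<alpha>) i a"
  unfolding opt_disc_cost_eq_SUP_value_iter[OF \<alpha>, of i] SUP_mult_left_ennreal
proof (rule SUP_least)
  fix n
  have "ennreal (\<alpha> - q i i a) * value_iter \<alpha> n i \<le> ennreal (\<alpha> - q i i a) * value_iter \<alpha> (Suc n) i"
    using incseqD[OF incseq_value_iter[OF \<alpha>], of n "Suc n"] by (intro mult_left_mono) (auto simp: le_fun_def)
  also have "\<dots> \<le> bellman (value_iter \<alpha> n) i a"
    by (rule value_iter_Suc_le[OF \<alpha> a])
  also have "\<dots> \<le> bellman (opt_disc_cost A q c \<alpha>) i a"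
    unfolding opt_disc_cost_eq_SUP_value_iter[OF \<alpha>, abs_def] by (intro bellman_mono SUP_upper) simp
  finally show "ennreal (\<alpha> - q i i a) * value_iter \<alpha> n i \<le> bellman (opt_disc_cost A q c \<alpha>) i a" .
qed

end

section \<open>First passage under a stationary policy\<close>

lemma nn_integral_count_space_eq_has_sum:
  fixes f :: "'a \<Rightarrow> real"
  assumes "(f has_sum s) I" "\<And>x. x \<in> I \<Longrightarrow> 0 \<le> f x"
  shows "(\<integral>\<^sup>+x. ennreal (f x) \<partial>count_space I) = ennreal s"
proof -
  have "f summable_on I" using assms(1) by (rule has_sum_imp_summable)
  then have "(\<lambda>x. norm (f x)) summable_on I"
    by (subst summable_on_cong[of _ _ f]) (use assms(2) in auto)
  then have "Infinite_Set_Sum.abs_summable_on f I" by (simp only: abs_summable_equivalent)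
  then show ?thesis
    using nn_integral_conv_infsetsum[of f I] infsetsum_infsum[of f I] infsumI[OF assms(1)] assms(2)
    by simp
qed

text \<open>One-step inequalities are summed in additive form, since subtraction is unreliable for
  possibly infinite values.\<close>

lemma telescope_le_ennreal:
  fixes a b f :: "nat \<Rightarrow> ennreal"
  assumes "\<And>n. n < N \<Longrightarrow> a n + f n \<le> b n + f (Suc n)"
  shows "(\<Sum>n<N. a n) + f 0 \<le> (\<Sum>n<N. b n) + f N"
  using assms
proof (induction N)
  case (Suc N)
  have "(\<Sum>n<Suc N. a n) + f 0 = a N + ((\<Sum>n<N. a n) + f 0)" by (simp add: ac_simps)
  also have "\<dots> \<le> a N + ((\<Sum>n<N. b n) + f N)" using Suc by (intro add_left_mono) auto
  also have "\<dots> = (\<Sum>n<N. b n) + (a N + f N)" by (simp add: ac_simps)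
  also have "\<dots> \<le> (\<Sum>n<N. b n) + (b N + f (Suc N))" using Suc.prems by (intro add_left_mono) auto
  finally show ?case by (simp add: ac_simps)
qed simp

lemma telescope_ge_ennreal:
  fixes a b f :: "nat \<Rightarrow> ennreal"
  assumes "\<And>n. n < N \<Longrightarrow> b n + f (Suc n) \<le> a n + f n"
  shows "(\<Sum>n<N. b n) + f N \<le> (\<Sum>n<N. a n) + f 0"
  using assms
proof (induction N)
  case (Suc N)
  have "(\<Sum>n<Suc N. b n) + f (Suc N) = (\<Sum>n<N. b n) + (b N + f (Suc N))" by (simp add: ac_simps)
  also have "\<dots> \<le> (\<Sum>n<N. b n) + (a N + f N)" using Suc.prems by (intro add_left_mono) auto
  also have "\<dots> = a N + ((\<Sum>n<N. b n) + f N)" by (simp add: ac_simps)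
  also have "\<dots> \<le> a N + ((\<Sum>n<N. a n) + f 0)" using Suc by (intro add_left_mono) auto
  finally show ?case by (simp add: ac_simps)
qed simp

lemma sum_le_SUP_lessThan: "(\<Sum>n<N. a n) \<le> (SUP N. \<Sum>n<N. (a n :: ennreal))"
  by (rule SUP_upper) simp

locale ctmdp_stationary = ctmdp A q c
  for A :: "'s::countable \<Rightarrow> 'b set" and q c +
  fixes e :: "'s \<Rightarrow> 'b"
  assumes e_in: "e j \<in> A j"
begin

abbreviation "exit_rate m \<equiv> st_rate q e m"

lemma exit_rate_nonneg: "0 \<le> exit_rate m"
  using q_diag_nonpos[OF e_in] by (simp add: st_rate_def)

lemma nn_integral_q: "(\<integral>\<^sup>+k. ennreal (q k m (e m)) \<partial>count_space (UNIV - {m})) = ennreal (exit_rate m)"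
  unfolding st_rate_def
  by (rule nn_integral_count_space_eq_has_sum[OF q_off_diagonal_has_sum]) (use e_in q_nonneg in auto)

text \<open>In an absorbing state \<open>jump_prob\<close> is 0 by default. This agrees with the
  rates: off the diagonal they are nonnegative with sum 0, so each of them vanishes.\<close>

lemma exit_rate_times_jump_prob:
  assumes "k \<noteq> m"
  shows "ennreal (exit_rate m) * ennreal (jump_prob q e m k) = ennreal (q k m (e m))"
proof (cases "exit_rate m = 0")
  case True
  have "ennreal (q k m (e m)) \<le> (\<integral>\<^sup>+k. ennreal (q k m (e m)) \<partial>count_space (UNIV - {m}))"
    using assms by (intro nn_integral_ge_point) auto
  then show ?thesis unfolding nn_integral_q using True by simp
next
  case False
  then show ?thesis using exit_rate_nonneg[of m] assms q_nonneg[OF e_in assms]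
    by (simp add: jump_prob_def less_le flip: ennreal_mult)
qed

lemma nn_integral_q_eq_jump:
  "(\<integral>\<^sup>+k. ennreal (q k m (e m)) * f k \<partial>count_space (UNIV - {m}))
     = ennreal (exit_rate m) * (\<integral>\<^sup>+k. ennreal (jump_prob q e m k) * f k \<partial>count_space UNIV)"
proof -
  have "(\<integral>\<^sup>+k. ennreal (jump_prob q e m k) * f k \<partial>count_space UNIV)
      = (\<integral>\<^sup>+k. ennreal (jump_prob q e m k) * f k \<partial>count_space (UNIV - {m}))"
    by (rule nn_integral_count_space_eq) (auto simp: jump_prob_def)
  moreover have "(\<integral>\<^sup>+k. ennreal (q k m (e m)) * f k \<partial>count_space (UNIV - {m}))
      = (\<integral>\<^sup>+k. ennreal (exit_rate m) * (ennreal (jump_prob q e m k) * f k) \<partial>count_space (UNIV - {m}))"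
    by (intro nn_integral_cong) (simp add: exit_rate_times_jump_prob flip: mult.assoc)
  ultimately show ?thesis by (simp add: nn_integral_cmult)
qed

end

section \<open>Occupation measure up to the first passage\<close>

locale ctmdp_passage = ctmdp_stationary A q c e
  for A :: "'s::countable \<Rightarrow> 'b set" and q c e +
  fixes G :: "'s set" and i :: 's
  assumes finite_passage: "mean_passage q e G i < \<infinity>"
begin

text \<open>Expected time in \<open>m\<close> during the sojourn after the \<open>n\<close>-th jump,
  on the event that no jump so far has entered \<open>G\<close>. In an absorbing state the mean
  holding time is infinite.\<close>

definition occupation_n :: "nat \<Rightarrow> 's \<Rightarrow> ennreal" where
  "occupation_n n m = taboo q e G i n m * inverse (ennreal (exit_rate m))"

definition occupation :: "'s \<Rightarrow> ennreal" where
  "occupation m = (\<Sum>n. occupation_n n m)"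

lemma mean_passage_eq_occupation: "mean_passage q e G i = (\<integral>\<^sup>+m. occupation m \<partial>count_space UNIV)"
  unfolding mean_passage_def occupation_def occupation_n_def by (rule nn_integral_suminf[symmetric]) simp

lemma occupation_n_le: "occupation_n n m \<le> occupation m"
  unfolding occupation_def using sum_le_suminf[of "\<lambda>n. occupation_n n m" "{n}"] by simp

text \<open>At an absorbing state the holding time is infinite, so a finite mean passage time forces
  the taboo probability there to be 0. Elsewhere the two rate factors cancel.\<close>

lemma occupation_n_times_exit_rate: "occupation_n n m * ennreal (exit_rate m) = taboo q e G i n m"
proof (cases "exit_rate m = 0")
  case True
  have "occupation_n n m \<le> mean_passage q e G i"
    unfolding mean_passage_eq_occupation
    by (rule order_trans[OF occupation_n_le]) (auto intro: nn_integral_ge_point)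
  then have "occupation_n n m \<noteq> \<top>" using finite_passage by (auto simp: top_unique)
  then show ?thesis using True by (auto simp: occupation_n_def ennreal_mult_eq_top_iff)
next
  case False
  then have "0 < exit_rate m" using exit_rate_nonneg[of m] by simp
  then have "inverse (ennreal (exit_rate m)) * ennreal (exit_rate m) = 1"
    by (simp add: inverse_ennreal flip: ennreal_mult)
  then show ?thesis by (simp add: occupation_n_def mult.assoc)
qed

lemma occupation_split_before:
  "(\<integral>\<^sup>+m. occupation_n n m * (x m + ennreal (exit_rate m) * f m) \<partial>count_space UNIV)
     = (\<integral>\<^sup>+m. occupation_n n m * x m \<partial>count_space UNIV)
       + (\<integral>\<^sup>+m. taboo q e G i n m * f m \<partial>count_space UNIV)"
  unfolding distrib_left mult.assoc[symmetric] occupation_n_times_exit_rate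
  by (rule nn_integral_add) auto

text \<open>Integration against the occupation of stage \<open>n\<close> turns rates into jumps. The
  next state lies in \<open>G\<close> and counts towards \<open>first_hit\<close>, or outside and
  counts towards the taboo distribution of stage \<open>Suc n\<close>.\<close>

lemma occupation_split_after:
  "(\<integral>\<^sup>+m. occupation_n n m * (y m + (\<integral>\<^sup>+k. ennreal (q k m (e m)) * f k \<partial>count_space (UNIV - {m}))) \<partial>count_space UNIV)
     = (\<integral>\<^sup>+m. occupation_n n m * y m \<partial>count_space UNIV)
       + (\<integral>\<^sup>+j. first_hit q e G i n j * f j \<partial>count_space UNIV)
       + (\<integral>\<^sup>+m. taboo q e G i (Suc n) m * f m \<partial>count_space UNIV)"
proof -
  let ?t = "taboo q e G i n"
  have "(\<integral>\<^sup>+m. ?t m * (\<integral>\<^sup>+k. ennreal (jump_prob q e m k) * f k \<partial>count_space UNIV) \<partial>count_space UNIV)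
      = (\<integral>\<^sup>+m. \<integral>\<^sup>+k. ?t m * ennreal (jump_prob q e m k) * f k \<partial>count_space UNIV \<partial>count_space UNIV)"
    by (simp add: nn_integral_cmult mult.assoc)
  also have "\<dots> = (\<integral>\<^sup>+k. \<integral>\<^sup>+m. ?t m * ennreal (jump_prob q e m k) * f k \<partial>count_space UNIV \<partial>count_space UNIV)"
    by (rule nn_integral_count_space_nn_integral) auto
  also have "\<dots> = (\<integral>\<^sup>+k. first_hit q e G i n k * f k + taboo q e G i (Suc n) k * f k \<partial>count_space UNIV)"
    by (intro nn_integral_cong) (simp add: nn_integral_multc first_hit_def)
  also have "\<dots> = (\<integral>\<^sup>+j. first_hit q e G i n j * f j \<partial>count_space UNIV)
       + (\<integral>\<^sup>+m. taboo q e G i (Suc n) m * f m \<partial>count_space UNIV)"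
    by (rule nn_integral_add) auto
  finally show ?thesis
    unfolding nn_integral_q_eq_jump occupation_split_before by (simp add: add.assoc)
qed

lemma sums_occupation:
  "(SUP N. \<Sum>n<N. \<integral>\<^sup>+m. occupation_n n m * x m \<partial>count_space UNIV)
     = (\<integral>\<^sup>+m. occupation m * x m \<partial>count_space UNIV)"
  unfolding suminf_eq_SUP[symmetric] occupation_def ennreal_suminf_multc[symmetric]
  by (rule nn_integral_suminf[symmetric]) simp

lemma sums_hit_dist:
  "(SUP N. \<Sum>n<N. \<integral>\<^sup>+j. first_hit q e G i n j * f j \<partial>count_space UNIV)
     = (\<integral>\<^sup>+j. hit_dist q e G i j * f j \<partial>count_space UNIV)"
  unfolding suminf_eq_SUP[symmetric] hit_dist_def ennreal_suminf_multc[symmetric]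
  by (rule nn_integral_suminf[symmetric]) simp

lemma taboo_0_integral: "(\<integral>\<^sup>+m. taboo q e G i 0 m * f m \<partial>count_space UNIV) = f i"
  by (subst nn_integral_count_space'[of "{i}"]) auto

text \<open>The telescoped remainder at stage \<open>N\<close> is an integral of \<open>value_iter \<alpha> 0 = 0\<close>; this is why the
  inequality needs no control of the optimal cost along the surviving paths.\<close>

lemma opt_disc_cost_passage_le:
  assumes \<alpha>: "0 < \<alpha>"
  defines "V \<equiv> opt_disc_cost A q c \<alpha>"
  shows "(\<integral>\<^sup>+m. occupation m * (ennreal \<alpha> * V m) \<partial>count_space UNIV) + V i
    \<le> (\<integral>\<^sup>+m. occupation m * ennreal (c m (e m)) \<partial>count_space UNIV)
      + (\<integral>\<^sup>+j. hit_dist q e G i j * V j \<partial>count_space UNIV)" (is "_ \<le> ?R")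
proof -
  let ?W = "value_iter \<alpha>"
  have V: "V = (\<lambda>i. SUP n. ?W n i)"
    unfolding V_def by (rule ext) (rule opt_disc_cost_eq_SUP_value_iter[OF \<alpha>])
  have mono: "?W n m \<le> ?W n' m" if "n \<le> n'" for n n' m
    using incseqD[OF incseq_value_iter[OF \<alpha>] that] by (simp add: le_fun_def)
  have bell: "ennreal \<alpha> * ?W (Suc n) m + ennreal (exit_rate m) * ?W (Suc n) m
      \<le> ennreal (c m (e m)) + (\<integral>\<^sup>+k. ennreal (q k m (e m)) * ?W n k \<partial>count_space (UNIV - {m}))" for n m
  proof -
    have "ennreal (\<alpha> - q m m (e m)) = ennreal \<alpha> + ennreal (exit_rate m)"
      using \<alpha> exit_rate_nonneg[of m] by (simp add: st_rate_def flip: ennreal_plus)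
    then show ?thesis
      using value_iter_Suc_le[OF \<alpha> e_in, of m n] by (simp only: bellman_def distrib_right)
  qed
  \<comment> \<open>The iterate index counts down, \<open>N - n\<close> after \<open>n\<close>
    jumps, so each Bellman step matches one jump and the telescope ends at iterate 0.\<close>
  have stage: "(\<Sum>n<N. \<integral>\<^sup>+m. occupation_n n m * (ennreal \<alpha> * ?W (N - n) m) \<partial>count_space UNIV) + ?W N i \<le> ?R" for N
  proof -
    have "(\<Sum>n<N. \<integral>\<^sup>+m. occupation_n n m * (ennreal \<alpha> * ?W (N - n) m) \<partial>count_space UNIV)
          + (\<integral>\<^sup>+m. taboo q e G i 0 m * ?W (N - 0) m \<partial>count_space UNIV)
        \<le> (\<Sum>n<N. (\<integral>\<^sup>+m. occupation_n n m * ennreal (c m (e m)) \<partial>count_space UNIV)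
            + (\<integral>\<^sup>+j. first_hit q e G i n j * ?W (N - Suc n) j \<partial>count_space UNIV))
          + (\<integral>\<^sup>+m. taboo q e G i N m * ?W (N - N) m \<partial>count_space UNIV)"
    proof (rule telescope_le_ennreal[where f="\<lambda>n. \<integral>\<^sup>+m. taboo q e G i n m * ?W (N - n) m \<partial>count_space UNIV"])
      fix n assume "n < N"
      then have "N - n = Suc (N - Suc n)" by simp
      then show "(\<integral>\<^sup>+m. occupation_n n m * (ennreal \<alpha> * ?W (N - n) m) \<partial>count_space UNIV)
          + (\<integral>\<^sup>+m. taboo q e G i n m * ?W (N - n) m \<partial>count_space UNIV)
        \<le> (\<integral>\<^sup>+m. occupation_n n m * ennreal (c m (e m)) \<partial>count_space UNIV)
            + (\<integral>\<^sup>+j. first_hit q e G i n j * ?W (N - Suc n) j \<partial>count_space UNIV)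
          + (\<integral>\<^sup>+m. taboo q e G i (Suc n) m * ?W (N - Suc n) m \<partial>count_space UNIV)"
        unfolding occupation_split_before[symmetric] occupation_split_after[symmetric]
        by (intro nn_integral_mono mult_left_mono) (simp_all only: bell zero_le)
    qed
    also have "\<dots> = (\<Sum>n<N. \<integral>\<^sup>+m. occupation_n n m * ennreal (c m (e m)) \<partial>count_space UNIV)
            + (\<Sum>n<N. \<integral>\<^sup>+j. first_hit q e G i n j * ?W (N - Suc n) j \<partial>count_space UNIV)"
      by (simp add: sum.distrib)
    also have "\<dots> \<le> (\<Sum>n<N. \<integral>\<^sup>+m. occupation_n n m * ennreal (c m (e m)) \<partial>count_space UNIV)
            + (\<Sum>n<N. \<integral>\<^sup>+j. first_hit q e G i n j * V j \<partial>count_space UNIV)"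
      unfolding V by (intro add_left_mono sum_mono nn_integral_mono mult_left_mono SUP_upper) auto
    also have "\<dots> \<le> ?R"
      unfolding sums_occupation[symmetric] sums_hit_dist[symmetric]
      by (intro add_mono sum_le_SUP_lessThan)
    finally show ?thesis by (simp add: taboo_0_integral del: taboo.simps)
  qed
  \<comment> \<open>The number \<open>N\<close> of stages is decoupled from the iterate
    \<open>M\<close>: with horizon \<open>N + M\<close>, the first \<open>N\<close> stages still see
    iterates of index at least \<open>M\<close>. The limits in \<open>N\<close> and \<open>M\<close>
    can then be taken one after the other.\<close>
  have "(\<Sum>n<N. \<integral>\<^sup>+m. occupation_n n m * (ennreal \<alpha> * ?W M m) \<partial>count_space UNIV) + ?W M i \<le> ?R" for N M
  proof -
    have "(\<Sum>n<N. \<integral>\<^sup>+m. occupation_n n m * (ennreal \<alpha> * ?W M m) \<partial>count_space UNIV) + ?W M i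
      \<le> (\<Sum>n<N. \<integral>\<^sup>+m. occupation_n n m * (ennreal \<alpha> * ?W (N + M - n) m) \<partial>count_space UNIV) + ?W (N + M) i"
      by (intro add_mono sum_mono nn_integral_mono mult_left_mono mono) auto
    also have "\<dots> \<le> (\<Sum>n<N+M. \<integral>\<^sup>+m. occupation_n n m * (ennreal \<alpha> * ?W (N + M - n) m) \<partial>count_space UNIV) + ?W (N + M) i"
      by (intro add_right_mono sum_mono2) auto
    finally show ?thesis using stage[of "N + M"] by simp
  qed
  then have "(SUP N. (\<Sum>n<N. \<integral>\<^sup>+m. occupation_n n m * (ennreal \<alpha> * ?W M m) \<partial>count_space UNIV) + ?W M i) \<le> ?R" for M
    by (intro SUP_least)
  then have "(\<integral>\<^sup>+m. occupation m * (ennreal \<alpha> * ?W M m) \<partial>count_space UNIV) + ?W M i \<le> ?R" for M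
    unfolding sums_occupation[symmetric] by (simp add: ennreal_SUP_add_left)
  then have "(SUP M. (\<integral>\<^sup>+m. occupation m * (ennreal \<alpha> * ?W M m) \<partial>count_space UNIV) + ?W M i) \<le> ?R"
    by (intro SUP_least)
  moreover have "(SUP M. (\<integral>\<^sup>+m. occupation m * (ennreal \<alpha> * ?W M m) \<partial>count_space UNIV) + ?W M i)
     = (SUP M. \<integral>\<^sup>+m. occupation m * (ennreal \<alpha> * ?W M m) \<partial>count_space UNIV) + (SUP M. ?W M i)"
    by (rule ennreal_SUP_add)
       (auto simp: incseq_def le_fun_def intro!: nn_integral_mono mult_left_mono mono)
  moreover have "(SUP M. \<integral>\<^sup>+m. occupation m * (ennreal \<alpha> * ?W M m) \<partial>count_space UNIV)
      = (\<integral>\<^sup>+m. occupation m * (ennreal \<alpha> * V m) \<partial>count_space UNIV)"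
    unfolding V SUP_mult_left_ennreal
    by (rule nn_integral_monotone_convergence_SUP[symmetric])
       (auto simp: incseq_def le_fun_def intro!: mult_left_mono mono)
  ultimately show ?thesis by (simp add: V)
qed

text \<open>The opposite telescope: here the remainder at stage \<open>N\<close> stands on the
  smaller side and, being nonnegative, is dropped.\<close>

lemma supersolution_passage_ge:
  assumes super: "\<And>m. y m + (\<integral>\<^sup>+k. ennreal (q k m (e m)) * f k \<partial>count_space (UNIV - {m}))
      \<le> x m + ennreal (exit_rate m) * f m"
  shows "(\<integral>\<^sup>+m. occupation m * y m \<partial>count_space UNIV)
      + (\<integral>\<^sup>+j. hit_dist q e G i j * f j \<partial>count_space UNIV)
    \<le> (\<integral>\<^sup>+m. occupation m * x m \<partial>count_space UNIV) + f i" (is "_ \<le> ?R")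
proof -
  have "(\<Sum>n<N. \<integral>\<^sup>+m. occupation_n n m * y m \<partial>count_space UNIV)
      + (\<Sum>n<N. \<integral>\<^sup>+j. first_hit q e G i n j * f j \<partial>count_space UNIV) \<le> ?R" for N
  proof -
    have "(\<Sum>n<N. (\<integral>\<^sup>+m. occupation_n n m * y m \<partial>count_space UNIV)
            + (\<integral>\<^sup>+j. first_hit q e G i n j * f j \<partial>count_space UNIV))
          + (\<integral>\<^sup>+m. taboo q e G i N m * f m \<partial>count_space UNIV)
        \<le> (\<Sum>n<N. \<integral>\<^sup>+m. occupation_n n m * x m \<partial>count_space UNIV)
          + (\<integral>\<^sup>+m. taboo q e G i 0 m * f m \<partial>count_space UNIV)"
      by (rule telescope_ge_ennreal[where f="\<lambda>n. \<integral>\<^sup>+m. taboo q e G i n m * f m \<partial>count_space UNIV"])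
         (auto simp only: occupation_split_before[symmetric] occupation_split_after[symmetric] zero_le
           intro!: nn_integral_mono mult_left_mono super)
    also have "\<dots> \<le> ?R"
      unfolding taboo_0_integral sums_occupation[symmetric] by (intro add_right_mono sum_le_SUP_lessThan)
    finally show ?thesis
      by (rule order_trans[rotated]) (simp add: sum.distrib)
  qed
  then have "(SUP N. (\<Sum>n<N. \<integral>\<^sup>+m. occupation_n n m * y m \<partial>count_space UNIV)
      + (\<Sum>n<N. \<integral>\<^sup>+j. first_hit q e G i n j * f j \<partial>count_space UNIV)) \<le> ?R"
    by (intro SUP_least)
  then show ?thesis
    unfolding sums_occupation[symmetric] sums_hit_dist[symmetric]
    by (subst ennreal_SUP_add[symmetric]) (auto simp: incseq_def intro!: sum_mono2)
qed

end

section \<open>Vanishing discount\<close>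

context ctmdp_stationary
begin

text \<open>The relative value is shifted by \<open>L\<close> to stay nonnegative, and the
  hypothesis on \<open>h\<close> expresses this without subtraction. The shift leaves an error
  \<open>\<alpha> * L\<close>, which vanishes with the discount.\<close>

lemma relative_value_local_le:
  assumes \<alpha>: "0 < \<alpha>" and v: "0 \<le> v" and L: "0 \<le> L"
    and h: "\<And>j. opt_disc_cost A q c \<alpha> j + ennreal L = ennreal v + h j"
  shows "ennreal (\<alpha> * v) + ennreal (exit_rate m) * h m
    \<le> ennreal (c m (e m)) + ennreal (\<alpha> * L)
      + (\<integral>\<^sup>+k. ennreal (q k m (e m)) * h k \<partial>count_space (UNIV - {m}))"
proof -
  let ?V = "opt_disc_cost A q c \<alpha>" and ?K = "count_space (UNIV - {m})" and ?r = "ennreal (exit_rate m)"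
  have split: "(\<integral>\<^sup>+k. ennreal (q k m (e m)) * (x + f k) \<partial>?K) = ?r * x + (\<integral>\<^sup>+k. ennreal (q k m (e m)) * f k \<partial>?K)"
    for x and f :: "'s \<Rightarrow> ennreal"
    by (simp add: distrib_left nn_integral_add nn_integral_multc nn_integral_q)
  have v_le: "ennreal v \<le> ?V m + ennreal L" unfolding h by simp
  have rate: "ennreal (\<alpha> - q m m (e m)) = ennreal \<alpha> + ?r"
    using \<alpha> exit_rate_nonneg[of m] by (simp add: st_rate_def flip: ennreal_plus)
  \<comment> \<open>The finite term \<open>?r * ennreal v\<close> is carried along on both sides to
    keep the computation additive, and is cancelled at the end.\<close>
  have "?r * ennreal v + (ennreal (\<alpha> * v) + ?r * h m) = ennreal \<alpha> * ennreal v + ?r * (?V m + ennreal L)"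
    unfolding h using \<alpha> v by (simp add: ennreal_mult distrib_left ac_simps)
  also have "\<dots> \<le> ennreal \<alpha> * (?V m + ennreal L) + ?r * (?V m + ennreal L)"
    by (intro add_right_mono mult_left_mono v_le) auto
  also have "\<dots> = ennreal (\<alpha> - q m m (e m)) * ?V m + (ennreal (\<alpha> * L) + ?r * ennreal L)"
    unfolding rate using \<alpha> L by (simp add: ennreal_mult algebra_simps)
  also have "\<dots> \<le> bellman ?V m (e m) + (ennreal (\<alpha> * L) + ?r * ennreal L)"
    by (intro add_right_mono opt_disc_cost_le_bellman \<alpha> e_in)
  also have "\<dots> = ennreal (c m (e m)) + ennreal (\<alpha> * L)
      + (\<integral>\<^sup>+k. ennreal (q k m (e m)) * (ennreal L + ?V k) \<partial>?K)"
    unfolding bellman_def split by (simp add: ac_simps)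
  also have "\<dots> = ?r * ennreal v + (ennreal (c m (e m)) + ennreal (\<alpha> * L)
      + (\<integral>\<^sup>+k. ennreal (q k m (e m)) * h k \<partial>?K))"
    unfolding add.commute[of "ennreal L"] h split by (simp add: ac_simps)
  finally show ?thesis
    by (simp only: ennreal_add_left_cancel_le) (auto simp: ennreal_mult_eq_top_iff)
qed

end

text \<open>As the passage occurs with probability 1, a constant added to the values on arrival adds
  just that constant to their mean. Hence \<open>v\<close> cancels, and the shift by
  \<open>L\<close> only costs \<open>\<alpha> * L\<close> per unit of time before the
  passage.\<close>

lemma (in ctmdp_passage) relative_value_passage_le:
  assumes \<alpha>: "0 < \<alpha>" and v: "0 \<le> v" and L: "0 \<le> L"
    and h: "\<And>j. opt_disc_cost A q c \<alpha> j + ennreal L = ennreal v + h j"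
    and hit: "hit_prob q e G i = 1"
  shows "ennreal (\<alpha> * v) * mean_passage q e G i + h i
    \<le> (\<integral>\<^sup>+m. occupation m * ennreal (c m (e m)) \<partial>count_space UNIV)
      + (\<integral>\<^sup>+j. hit_dist q e G i j * h j \<partial>count_space UNIV)
      + ennreal (\<alpha> * L) * mean_passage q e G i"
proof -
  let ?V = "opt_disc_cost A q c \<alpha>" and ?T = "mean_passage q e G i" and ?U = "count_space (UNIV :: 's set)"
  let ?C = "\<integral>\<^sup>+m. occupation m * ennreal (c m (e m)) \<partial>?U"
  have hit_split: "(\<integral>\<^sup>+j. hit_dist q e G i j * (x + f j) \<partial>?U) = x + (\<integral>\<^sup>+j. hit_dist q e G i j * f j \<partial>?U)"
    for x and f :: "'s \<Rightarrow> ennreal"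
    using hit by (simp add: hit_prob_def distrib_left nn_integral_add nn_integral_multc)
  have occ_const: "(\<integral>\<^sup>+m. occupation m * x \<partial>?U) = x * ?T" for x
    by (simp add: mean_passage_eq_occupation nn_integral_multc mult.commute[of x])
  have "ennreal v + (ennreal (\<alpha> * v) * ?T + h i) = (\<integral>\<^sup>+m. occupation m * (ennreal \<alpha> * ennreal v) \<partial>?U) + (?V i + ennreal L)"
    unfolding h occ_const using \<alpha> v by (simp add: ennreal_mult ac_simps)
  also have "\<dots> \<le> (\<integral>\<^sup>+m. occupation m * (ennreal \<alpha> * (?V m + ennreal L)) \<partial>?U) + (?V i + ennreal L)"
    unfolding h by (intro add_right_mono nn_integral_mono mult_left_mono) auto
  also have "\<dots> = (\<integral>\<^sup>+m. occupation m * (ennreal \<alpha> * ?V m) + occupation m * ennreal (\<alpha> * L) \<partial>?U) + (?V i + ennreal L)"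
    using \<alpha> L by (simp add: distrib_left ennreal_mult)
  also have "\<dots> = ((\<integral>\<^sup>+m. occupation m * (ennreal \<alpha> * ?V m) \<partial>?U) + ?V i) + (ennreal (\<alpha> * L) * ?T + ennreal L)"
    by (subst nn_integral_add) (simp_all only: occ_const add_ac borel_measurable_count_space)
  also have "\<dots> \<le> (?C + (\<integral>\<^sup>+j. hit_dist q e G i j * ?V j \<partial>?U)) + (ennreal (\<alpha> * L) * ?T + ennreal L)"
    by (intro add_right_mono opt_disc_cost_passage_le[OF \<alpha>])
  also have "\<dots> = ?C + (\<integral>\<^sup>+j. hit_dist q e G i j * (ennreal L + ?V j) \<partial>?U) + ennreal (\<alpha> * L) * ?T"
    unfolding hit_split by (simp add: ac_simps)
  also have "\<dots> = ennreal v + (?C + (\<integral>\<^sup>+j. hit_dist q e G i j * h j \<partial>?U) + ennreal (\<alpha> * L) * ?T)"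
    unfolding add.commute[of "ennreal L"] h hit_split by (simp add: ac_simps)
  finally show ?thesis
    by (simp only: ennreal_add_left_cancel_le) auto
qed

text \<open>A single target gives a single finite term. This reduces passage to \<open>i0\<close>,
  and return to a non-absorbing \<open>i\<close>, to condition (i).\<close>

lemma nn_integral_count_space_singleton_hit_dist_finite:
  assumes "hit_prob q e {x} i = 1"
  shows "(\<integral>\<^sup>+j. ennreal (H j) * hit_dist q e {x} i j \<partial>count_space {x}) < \<infinity>"
proof -
  have "hit_dist q e {x} i x \<le> hit_prob q e {x} i"
    unfolding hit_prob_def by (rule nn_integral_ge_point) simp
  then have "hit_dist q e {x} i x < \<top>" using assms by (simp add: le_less_trans)
  then show ?thesis by (simp add: nn_integral_count_space_finite ennreal_mult_less_top)
qed

lemma hit_dist_eq_0: "j \<notin> G \<Longrightarrow> hit_dist q e G i j = 0"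
  by (simp add: hit_dist_def first_hit_def)

text \<open>Dominated convergence with majorant \<open>w j * ennreal (B j)\<close>. The weights are
  finite because an infinite weight times values tending to 0 need not tend to 0.\<close>

lemma tendsto_nn_integral_count_space_dominated:
  fixes h :: "nat \<Rightarrow> 's \<Rightarrow> real" and w :: "'s \<Rightarrow> ennreal"
  assumes "\<And>j. j \<in> I \<Longrightarrow> (\<lambda>n. h n j) \<longlonglongrightarrow> h' j" "\<And>n j. h n j \<le> B j"
    and "(\<integral>\<^sup>+j. w j * ennreal (B j) \<partial>count_space I) < \<infinity>"
    and "\<And>j. j \<in> I \<Longrightarrow> w j \<noteq> \<top>"
  shows "(\<lambda>n. \<integral>\<^sup>+j. w j * ennreal (h n j) \<partial>count_space I) \<longlonglongrightarrow> (\<integral>\<^sup>+j. w j * ennreal (h' j) \<partial>count_space I)"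
proof (rule nn_integral_dominated_convergence[where w="\<lambda>j. w j * ennreal (B j)"])
  show "AE j in count_space I. w j * ennreal (h n j) \<le> w j * ennreal (B j)" for n
    using assms(2) by (auto simp: AE_count_space intro!: mult_left_mono ennreal_leI)
  show "AE j in count_space I. (\<lambda>n. w j * ennreal (h n j)) \<longlonglongrightarrow> w j * ennreal (h' j)"
    using assms(1,4) by (auto simp: AE_count_space less_top intro!: ennreal_tendsto_cmult tendsto_ennrealI)
qed (use assms in auto)

theorem theorem1:
  fixes A :: "'s::countable \<Rightarrow> 'b set"
    and q :: "'s \<Rightarrow> 's \<Rightarrow> 'b \<Rightarrow> real"
    and c :: "'s \<Rightarrow> 'b \<Rightarrow> real"
    and \<alpha> :: "nat \<Rightarrow> real" and i0 :: 's
    and H :: "'s \<Rightarrow> real" and L :: real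
    and r :: "nat \<Rightarrow> nat" and g :: real and hs :: "'s \<Rightarrow> real"
    and e :: "'s \<Rightarrow> 'b" and \<Phi> :: "'s \<Rightarrow> real" and i :: 's
  assumes A_fin: "\<forall>i. finite (A i) \<and> A i \<noteq> {}"
    and q_cons: "conservative A q"
    and c_nonneg: "\<forall>i. \<forall>a\<in>A i. 0 \<le> c i a"
    and nonexp: "nonexplosive A q"
    and alpha_dec: "decseq \<alpha>" and alpha_pos: "\<forall>n. 0 < \<alpha> n" and alpha_lim: "\<alpha> \<longlonglongrightarrow> 0"
    and A1: "\<exists>B::real. \<forall>n. ennreal (\<alpha> n) * opt_disc_cost A q c (\<alpha> n) i0 \<le> ennreal B"
    and A2: "\<forall>j. 0 \<le> H j"
      "\<forall>j n. opt_disc_cost A q c (\<alpha> n) j \<le> opt_disc_cost A q c (\<alpha> n) i0 + ennreal (H j)"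
    and A3: "0 \<le> L" "\<forall>j n. opt_disc_cost A q c (\<alpha> n) i0 \<le> opt_disc_cost A q c (\<alpha> n) j + ennreal L"
    and subseq: "strict_mono r"
    and g_lim: "(\<lambda>k. \<alpha> (r k) * enn2real (opt_disc_cost A q c (\<alpha> (r k)) i0)) \<longlonglongrightarrow> g"
    and h_lim: "\<forall>j. (\<lambda>k. hdiff A q c i0 (\<alpha> (r k)) j) \<longlonglongrightarrow> hs j"
    and ACOI: "\<forall>j. (MIN a\<in>A j. ereal (c j a) + drift q hs j a) \<le> ereal g"
    and e_min: "\<forall>j. e j \<in> A j \<and> ereal (c j (e j)) + drift q hs j (e j) = (MIN a\<in>A j. ereal (c j a) + drift q hs j a)"
    and Phi_def: "\<forall>j. ereal g = ereal (c j (e j)) + ereal (\<Phi> j) + drift q hs j (e j)"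
    and cond: "(\<exists>G. G \<noteq> {} \<and> in_R q e i G \<and>
                  (\<integral>\<^sup>+ j. ennreal (H j) * hit_dist q e G i j \<partial>count_space G) < \<infinity>)
             \<or> in_R q e i {i0}
             \<or> positive_recurrent q e i
             \<or> (\<forall>a\<in>A i. (\<lambda>j. \<bar>q j i a\<bar> * H j) summable_on UNIV)"
  shows "\<Phi> i = 0 \<and> ereal g = (MIN a\<in>A i. ereal (c i a) + drift q hs i a)"
proof -

  \<comment> \<open>Relative values along the subsequence\<close>
  interpret ctmdp_stationary A q c e
    by unfold_locales (use A_fin q_cons c_nonneg e_min in auto)
  define a where "a k = \<alpha> (r k)" for k
  define v where "v k = enn2real (opt_disc_cost A q c (a k) i0)" for k
  \<comment> \<open>By (A3) the shift by \<open>L\<close> makes the relative values nonnegative, so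
    weighted sums over states can be formed in \<open>ennreal\<close> even if they diverge.\<close>
  define h where "h k j = hdiff A q c i0 (a k) j + L" for k j
  define hl where "hl j = hs j + L" for j
  have a_pos: "0 < a k" for k using alpha_pos by (simp add: a_def)
  have a_lim: "a \<longlonglongrightarrow> 0"
    unfolding a_def using LIMSEQ_subseq_LIMSEQ[OF alpha_lim subseq] by (simp add: comp_def)
  have v0: "0 \<le> v k" for k by (simp add: v_def)
  \<comment> \<open>(A1) gives finiteness at \<open>i0\<close>, since \<open>a k\<close> is
    positive, and (A2) carries it to every state. Hence \<open>enn2real\<close>, which sends
    infinity to 0, loses nothing in \<open>hdiff\<close>.\<close>
  have J_fin: "opt_disc_cost A q c (a k) j < \<top>" for k j
  proof -
    obtain B where "ennreal (a k) * opt_disc_cost A q c (a k) i0 \<le> ennreal B"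
      using A1 by (auto simp: a_def)
    then have "ennreal (a k) * opt_disc_cost A q c (a k) i0 < \<top>" by (simp add: le_less_trans)
    then have "opt_disc_cost A q c (a k) i0 < \<top>" using a_pos[of k] by (auto simp: ennreal_mult_less_top)
    moreover have "opt_disc_cost A q c (a k) j \<le> opt_disc_cost A q c (a k) i0 + ennreal (H j)"
      using A2 by (simp add: a_def)
    ultimately show ?thesis by (simp add: le_less_trans)
  qed
  have J_eq: "opt_disc_cost A q c (a k) j = ennreal (enn2real (opt_disc_cost A q c (a k) j))" for k j
    using J_fin by simp
  have h0: "0 \<le> h k j" for k j
  proof -
    have "ennreal (v k) \<le> ennreal (enn2real (opt_disc_cost A q c (a k) j) + L)"
      using A3(2)[rule_format, of "r k" j] A3(1) J_fin[of k] by (simp add: a_def v_def ennreal_plus)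
    then have "v k \<le> enn2real (opt_disc_cost A q c (a k) j) + L"
      by (subst (asm) ennreal_le_iff) (use A3(1) in auto)
    then show ?thesis by (simp add: h_def hdiff_def v_def)
  qed
  have hH: "h k j \<le> H j + L" for k j
  proof -
    have "ennreal (enn2real (opt_disc_cost A q c (a k) j)) \<le> ennreal (v k + H j)"
      using A2(2)[rule_format, of "r k" j] A2(1) J_fin[of k] by (simp add: a_def v_def ennreal_plus)
    then have "enn2real (opt_disc_cost A q c (a k) j) \<le> v k + H j"
      by (subst (asm) ennreal_le_iff) (use A2(1) v0[of k] in auto)
    then show ?thesis by (simp add: h_def hdiff_def v_def)
  qed
  have J_h: "opt_disc_cost A q c (a k) j + ennreal L = ennreal (v k) + ennreal (h k j)" for k j
    using A3(1) h0[of k j] v0[of k]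
    by (subst J_eq) (simp add: h_def hdiff_def v_def flip: ennreal_plus)
  have h_hl: "(\<lambda>k. h k j) \<longlonglongrightarrow> hl j" for j
    unfolding h_def hl_def a_def using h_lim by (intro tendsto_intros) auto
  have hl0: "0 \<le> hl j" for j
    by (rule LIMSEQ_le_const[OF h_hl]) (use h0 in auto)
  have av: "(\<lambda>k. ennreal (a k * v k)) \<longlonglongrightarrow> ennreal g"
    using g_lim by (intro tendsto_ennrealI) (simp add: a_def v_def)
  have g0: "0 \<le> g"
    by (rule LIMSEQ_le_const[OF g_lim]) (use alpha_pos in \<open>simp add: less_imp_le\<close>)
  have "(\<lambda>k. ennreal (a k * L)) \<longlonglongrightarrow> ennreal (0 * L)"
    by (intro tendsto_ennrealI tendsto_mult a_lim tendsto_const)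
  then have aL: "(\<lambda>k. ennreal (a k * L)) \<longlonglongrightarrow> 0" by simp

  \<comment> \<open>The left side of the equation for \<open>\<Phi>\<close> is finite, which
    excludes the value infinity of \<open>drift\<close>; the series is therefore summable.\<close>
  have drift_e: "((\<lambda>k. hs k * q k j (e j)) has_sum (g - c j (e j) - \<Phi> j)) UNIV" for j
  proof -
    have s: "(\<lambda>k. hs k * q k j (e j)) summable_on UNIV"
      using Phi_def[rule_format, of j] by (auto simp: drift_def split: if_splits)
    with Phi_def[rule_format, of j] have "infsum (\<lambda>k. hs k * q k j (e j)) UNIV = g - c j (e j) - \<Phi> j"
      by (simp add: drift_def)
    with has_sum_infsum[OF s] show ?thesis by simp
  qed
  \<comment> \<open>This follows from the optimality inequality, because \<open>e\<close> attains
    the minimum.\<close>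
  have Phi0: "0 \<le> \<Phi> j" for j
  proof -
    have "drift q hs j (e j) = ereal (g - c j (e j) - \<Phi> j)"
      using drift_e[of j] by (auto simp: drift_def has_sum_imp_summable infsumI)
    moreover have "ereal (c j (e j)) + drift q hs j (e j) \<le> ereal g"
      using ACOI e_min by simp
    ultimately show ?thesis by simp
  qed
  have c0: "0 \<le> c j (e j)" for j using c_nonneg e_in by auto
  \<comment> \<open>Conservativeness allows \<open>L\<close> to be added to \<open>hs\<close>.
    Moving the diagonal term and \<open>\<Phi>\<close> across then leaves an identity between
    nonnegative quantities.\<close>
  have acoi: "ennreal (c m (e m)) + ennreal (\<Phi> m)
      + (\<integral>\<^sup>+k. ennreal (q k m (e m)) * ennreal (hl k) \<partial>count_space (UNIV - {m}))
      = ennreal g + ennreal (exit_rate m) * ennreal (hl m)" for m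
  proof -
    have "((\<lambda>k. q k m (e m)) has_sum 0) UNIV" using q_cons e_in by (auto simp: conservative_def)
    from has_sum_add[OF drift_e has_sum_cmult_right[OF this, of L]]
    have "((\<lambda>k. q k m (e m) * hl k) has_sum (g - c m (e m) - \<Phi> m)) UNIV"
      by (simp add: hl_def algebra_simps)
    from has_sum_Diff[OF this has_sum_finite[of "{m}"]]
    have S: "((\<lambda>k. q k m (e m) * hl k) has_sum (g - c m (e m) - \<Phi> m + exit_rate m * hl m)) (UNIV - {m})"
      by (simp add: st_rate_def)
    have nn: "0 \<le> q k m (e m) * hl k" if "k \<in> UNIV - {m}" for k
      using that q_nonneg[OF e_in] hl0 by (intro mult_nonneg_nonneg) auto
    have "(\<integral>\<^sup>+k. ennreal (q k m (e m)) * ennreal (hl k) \<partial>count_space (UNIV - {m}))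
        = (\<integral>\<^sup>+k. ennreal (q k m (e m) * hl k) \<partial>count_space (UNIV - {m}))"
      by (intro nn_integral_cong) (simp add: ennreal_mult'' hl0)
    also have "\<dots> = ennreal (g - c m (e m) - \<Phi> m + exit_rate m * hl m)"
      by (rule nn_integral_count_space_eq_has_sum[OF S nn])
    finally show ?thesis
      using has_sum_nonneg[OF S nn] c0[of m] Phi0[of m] g0 exit_rate_nonneg[of m] hl0[of m]
      by (simp flip: ennreal_plus ennreal_mult)
  qed

  \<comment> \<open>Summability of \<open>H\<close> against the rates out of \<open>i\<close> lets
    the one-step inequality at \<open>i\<close> pass to the limit; compared with
    \<open>acoi\<close>, it leaves no room for a positive \<open>\<Phi> i\<close>.\<close>
  have local_case: "\<Phi> i = 0"
    if fin: "(\<integral>\<^sup>+k. ennreal (q k i (e i)) * ennreal (H k) \<partial>count_space (UNIV - {i})) < \<infinity>"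
  proof -
    let ?I = "\<lambda>f. \<integral>\<^sup>+k. ennreal (q k i (e i)) * ennreal (f k) \<partial>count_space (UNIV - {i})"
    have "?I (\<lambda>k. H k + L) = ?I H + (\<integral>\<^sup>+k. ennreal (q k i (e i)) * ennreal L \<partial>count_space (UNIV - {i}))"
      using A2(1) A3(1) by (simp add: distrib_left nn_integral_add)
    then have finL: "?I (\<lambda>k. H k + L) < \<infinity>"
      using fin by (simp add: nn_integral_multc nn_integral_q ennreal_mult_less_top)
    have "(\<lambda>n. ?I (h n)) \<longlonglongrightarrow> ?I hl"
      by (rule tendsto_nn_integral_count_space_dominated[OF h_hl hH finL]) auto
    then have R: "(\<lambda>n. ennreal (c i (e i)) + ennreal (a n * L) + ?I (h n)) \<longlonglongrightarrow> ennreal (c i (e i)) + 0 + ?I hl"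
      by (intro tendsto_add tendsto_const aL)
    have Lm: "(\<lambda>n. ennreal (a n * v n) + ennreal (exit_rate i) * ennreal (h n i)) \<longlonglongrightarrow> ennreal g + ennreal (exit_rate i) * ennreal (hl i)"
      by (intro tendsto_add av ennreal_tendsto_cmult tendsto_ennrealI h_hl) simp
    have "ennreal g + ennreal (exit_rate i) * ennreal (hl i) \<le> ennreal (c i (e i)) + 0 + ?I hl"
      by (rule LIMSEQ_le[OF Lm R]) (use relative_value_local_le[OF a_pos v0 A3(1) J_h] in blast)
    then have "(ennreal (c i (e i)) + ?I hl) + ennreal (\<Phi> i) \<le> (ennreal (c i (e i)) + ?I hl) + 0"
      unfolding acoi[symmetric] by (simp add: ac_simps)
    moreover have "ennreal (c i (e i)) + ?I hl \<noteq> \<top>"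
    proof -
      have "ennreal (c i (e i)) + ?I hl \<le> ennreal g + ennreal (exit_rate i) * ennreal (hl i)"
        unfolding acoi[symmetric] by (intro add_right_mono) simp
      also have "\<dots> < \<top>" by (simp add: ennreal_mult_less_top)
      finally show ?thesis by simp
    qed
    ultimately have "ennreal (\<Phi> i) \<le> 0" by (simp only: ennreal_add_left_cancel_le) auto
    then show ?thesis using Phi0[of i] by (simp add: ennreal_eq_0_iff)
  qed

  have passage_case: "\<Phi> i = 0"
    if R: "in_R q e i G" and fin: "(\<integral>\<^sup>+ j. ennreal (H j) * hit_dist q e G i j \<partial>count_space G) < \<infinity>" for G
  proof -
    from R have hit: "hit_prob q e G i = 1" and T_fin: "mean_passage q e G i < \<infinity>"
      by (auto simp: in_R_def)
    interpret ctmdp_passage A q c e G i by unfold_locales (rule T_fin)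
    let ?T = "mean_passage q e G i" and ?U = "count_space (UNIV :: 's set)"
    let ?C = "\<integral>\<^sup>+m. occupation m * ennreal (c m (e m)) \<partial>?U"
    let ?I = "\<lambda>f. \<integral>\<^sup>+j. hit_dist q e G i j * ennreal (f j) \<partial>?U"
    have "hit_dist q e G i j \<le> hit_prob q e G i" for j
      unfolding hit_prob_def by (rule nn_integral_ge_point) simp
    then have hit_top: "hit_dist q e G i j \<noteq> \<top>" for j
      using hit by (metis ennreal_one_neq_top neq_top_trans)
    \<comment> \<open>\<open>hit_dist\<close> vanishes off \<open>G\<close>, so the assumed bound
      over \<open>G\<close> holds for the sum over all states.\<close>
    have "?I H = (\<integral>\<^sup>+ j. ennreal (H j) * hit_dist q e G i j \<partial>count_space G)"
      unfolding mult.commute[of "ennreal _"]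
      by (rule nn_integral_count_space_eq) (auto simp: hit_dist_eq_0)
    moreover have "?I (\<lambda>j. H j + L) = ?I H + (\<integral>\<^sup>+j. hit_dist q e G i j * ennreal L \<partial>?U)"
      using A2(1) A3(1) by (simp add: distrib_left nn_integral_add)
    ultimately have finL: "?I (\<lambda>j. H j + L) < \<infinity>"
      using fin hit by (simp add: nn_integral_multc hit_prob_def)
    have "(\<lambda>n. ?I (h n)) \<longlonglongrightarrow> ?I hl"
      by (rule tendsto_nn_integral_count_space_dominated[OF h_hl hH finL hit_top])
    moreover have "(\<lambda>n. ennreal (a n * L) * ?T) \<longlonglongrightarrow> 0 * ?T"
      unfolding mult.commute[of _ ?T] using T_fin by (intro ennreal_tendsto_cmult aL) simp
    ultimately have R: "(\<lambda>n. ?C + ?I (h n) + ennreal (a n * L) * ?T) \<longlonglongrightarrow> ?C + ?I hl + 0 * ?T"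
      by (intro tendsto_add tendsto_const)
    have Lm: "(\<lambda>n. ennreal (a n * v n) * ?T + ennreal (h n i)) \<longlonglongrightarrow> ennreal g * ?T + ennreal (hl i)"
      unfolding mult.commute[of _ ?T] using T_fin
      by (intro tendsto_add ennreal_tendsto_cmult av tendsto_ennrealI h_hl) simp
    have "ennreal g * ?T + ennreal (hl i) \<le> ?C + ?I hl + 0 * ?T"
      by (rule LIMSEQ_le[OF Lm R]) (use relative_value_passage_le[OF a_pos v0 A3(1) J_h hit] in blast)
    then have up: "ennreal g * ?T + ennreal (hl i) \<le> ?C + ?I hl" by simp
    \<comment> \<open>The reverse inequality treats \<open>\<Phi>\<close> as an additional running
      cost; together with \<open>up\<close> it forces the accumulated \<open>\<Phi>\<close> to be
      0.\<close>
    have "(\<integral>\<^sup>+m. occupation m * (ennreal (c m (e m)) + ennreal (\<Phi> m)) \<partial>?U) + ?I hl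
        \<le> (\<integral>\<^sup>+m. occupation m * ennreal g \<partial>?U) + ennreal (hl i)"
      by (rule supersolution_passage_ge[where f="\<lambda>j. ennreal (hl j)"]) (simp only: acoi order_refl)
    also have "(\<integral>\<^sup>+m. occupation m * ennreal g \<partial>?U) = ennreal g * ?T"
      by (simp add: mean_passage_eq_occupation nn_integral_multc mult.commute[of "ennreal g"])
    also have "(\<integral>\<^sup>+m. occupation m * (ennreal (c m (e m)) + ennreal (\<Phi> m)) \<partial>?U)
        = ?C + (\<integral>\<^sup>+m. occupation m * ennreal (\<Phi> m) \<partial>?U)"
      by (simp add: distrib_left nn_integral_add)
    finally have lo: "(?C + ?I hl) + (\<integral>\<^sup>+m. occupation m * ennreal (\<Phi> m) \<partial>?U) \<le> ennreal g * ?T + ennreal (hl i)"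
      by (simp add: ac_simps)
    have "ennreal g * ?T + ennreal (hl i) < \<top>" using T_fin by (simp add: ennreal_mult_less_top)
    then have "?C + ?I hl \<noteq> \<top>" using lo by (auto simp: top_unique)
    moreover have "(?C + ?I hl) + (\<integral>\<^sup>+m. occupation m * ennreal (\<Phi> m) \<partial>?U) \<le> (?C + ?I hl) + 0"
      using order_trans[OF lo up] by simp
    ultimately have "(\<integral>\<^sup>+m. occupation m * ennreal (\<Phi> m) \<partial>?U) \<le> 0"
      by (simp only: ennreal_add_left_cancel_le) auto
    \<comment> \<open>Stage 0 counts the starting state whether or not it lies in \<open>G\<close>,
      and its mean holding time is nonzero because the exit rate is finite.\<close>
    moreover have "occupation_n 0 i * ennreal (\<Phi> i) \<le> (\<integral>\<^sup>+m. occupation m * ennreal (\<Phi> m) \<partial>?U)"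
      by (rule order_trans[OF mult_right_mono[OF occupation_n_le]]) (auto intro: nn_integral_ge_point)
    ultimately have "occupation_n 0 i * ennreal (\<Phi> i) = 0" by simp
    then show ?thesis using Phi0[of i] by (auto simp: occupation_n_def ennreal_eq_0_iff)
  qed

  \<comment> \<open>Reduction of the four conditions to the two cases\<close>
  from cond have "\<Phi> i = 0"
  proof (elim disjE exE conjE)
    assume "in_R q e i {i0}"
    then show ?thesis
      using nn_integral_count_space_singleton_hit_dist_finite[of q e i0 i H]
      by (intro passage_case[of "{i0}"]) (auto simp: in_R_def)
  next
    assume pr: "positive_recurrent q e i"
    show ?thesis
    proof (cases "exit_rate i = 0")
      \<comment> \<open>In an absorbing state no rate out of \<open>i\<close> is positive, so the
        sum required by \<open>local_case\<close> is 0.\<close>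
      case True
      then have "ennreal (q k i (e i)) = 0" if "k \<noteq> i" for k
        using exit_rate_times_jump_prob[OF that] by simp
      then have "(\<integral>\<^sup>+k. ennreal (q k i (e i)) * ennreal (H k) \<partial>count_space (UNIV - {i}))
          = (\<integral>\<^sup>+k. 0 \<partial>count_space (UNIV - {i}))"
        by (intro nn_integral_cong) auto
      then show ?thesis by (intro local_case) simp
    next
      case False
      then have "in_R q e i {i}" using pr by (simp add: positive_recurrent_def)
      then show ?thesis
        using nn_integral_count_space_singleton_hit_dist_finite[of q e i i H]
        by (intro passage_case[of "{i}"]) (auto simp: in_R_def)
    qed
  next
    \<comment> \<open>Off the diagonal the absolute values disappear, so (iv) at the action
      \<open>e i\<close> yields the finiteness required by \<open>local_case\<close>.\<close>
    assume "\<forall>a\<in>A i. (\<lambda>j. \<bar>q j i a\<bar> * H j) summable_on UNIV"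
    then have "(\<lambda>j. \<bar>q j i (e i)\<bar> * H j) summable_on UNIV - {i}"
      using e_in by (blast intro: summable_on_subset_banach)
    from nn_integral_count_space_eq_has_sum[OF has_sum_infsum[OF this]]
    have "(\<integral>\<^sup>+j. ennreal (\<bar>q j i (e i)\<bar> * H j) \<partial>count_space (UNIV - {i})) < \<infinity>"
      using A2(1) by simp
    also have "(\<integral>\<^sup>+j. ennreal (\<bar>q j i (e i)\<bar> * H j) \<partial>count_space (UNIV - {i}))
        = (\<integral>\<^sup>+j. ennreal (q j i (e i)) * ennreal (H j) \<partial>count_space (UNIV - {i}))"
      using A2(1) q_nonneg[OF e_in] by (intro nn_integral_cong) (simp add: ennreal_mult'')
    finally show ?thesis by (rule local_case)
  qed (rule passage_case)
  then show ?thesis using Phi_def[rule_format, of i] e_min by simp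
qed

end
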